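(* Let $d\ge3$ and let $f\ge0$ be a measurable function on $X_1\times\dots\times X_d$. Suppose there is $b\in(2,\infty]$ such that $f\in L_p$ for all $p\in[2,b)$ and, with $$\nu_L(p):=W^{(d)}_L[f](p),\qquad \nu(p):=\sup_L\nu_L(p),$$ one has $\nu(p)<\infty$ for all $p\in[2,b)$, where $L$ ranges over all integer boxes $\prod_{s=1}^d\{1,\dots,n(s)\}$, $n(s)\ge1$. For a function $\psi:[2,b)\to[0,\infty)$ put $\zeta_\psi(p)=p\ln\psi(p)$ (with $\ln 0=-\infty$) and $\zeta_\psi^*(u)=\sup_{p\in[2,b)}(pu-\zeta_\psi(p))$. Then for every such box $L$ and every $y\ge e$, $$\mathbf P(S_L[f]\ge y)\le\exp\big(-\zeta^*_{\nu_L}(\ln y)\big),$$ and for every $y\ge e$, $$\sup_L\mathbf P(S_L[f]\ge y)\le\exp\big(-\zeta^*_{\nu}(\ln y)\big).$$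
   Context: $(X_s,\mu_s)$, $s=1,\dots,d$, are probability spaces. $\xi_i(s)$, $i=1,2,\dots$, $s=1,\dots,d$, are jointly independent random variables, $\xi_i(s)$ being $X_s$-valued with law $\mu_s$. $|\cdot|_p$ denotes the $L_p$ norm of a function (with respect to the product measure) or of a random variable. For finite non-empty $L\subset\{1,2,\dots\}^d$ with $|L|$ elements, $S_L[f]=|L|^{-1}\sum_{\vec k\in L}f(\xi_{k(1)}(1),\dots,\xi_{k(d)}(d))$. Bell function: $B(p)=e^{-1}\sum_{k=0}^\infty k^p/k!$. For a sequence $\vec\zeta=(\zeta_j)$ of non-negative independent random variables put $m_j(p)=\mathbf E\zeta_j^p$, $$A_{p,n}[\vec\zeta]=n^{-1}\sum_{j=1}^n m_j(p)^{1/p},\qquad V_{p,n}[\vec\zeta]=n^{-1}B(p)^{1/p}\max\Big\{\Big(\sum_{j=1}^n m_j(p)\Big)^{1/p},\ \sum_{j=1}^n m_j(1)\Big\},$$ $\Theta_{p,n}[\vec\zeta]=\min\{A_{p,n}[\vec\zeta],V_{p,n}[\vec\zeta]\}$. For $g\ge0$ on $X_s$, $\Theta_{p,n}[g]:=\Theta_{p,n}[(g(\xi_i(s)))_i]$. For $\vec k\in\{1,2,\dots\}^d$ put $N(\vec k)=\max_s k(s)$. For an integer $M\ge1$, $D^+[M]$ (depending on $p$) is the set of non-negative functions $\tilde f(\vec x)=\sum_{N(\vec k)\le M}\lambda(\vec k)\prod_{s=1}^d g^{(s)}_{k(s)}(x(s))$ with $\lambda(\vec k)\in\mathbb R$ and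 $0\le g^{(s)}_{k}\in L_p(X_s)$. Given such a representation and the box $L=\prod_s\{1,\dots,n(s)\}$, $|||\tilde f|||\Theta_{p,L}=\sum_{N(\vec k)\le M}|\lambda(\vec k)|\prod_{s=1}^d\Theta_{p,n(s)}[g^{(s)}_{k(s)}]$. $Q^+_M[f]_p=\inf_{\tilde f\in D^+[M]}|f-\tilde f|_p$; it is a standing assumption that this infimum is attained for each $M$ and $p$, and $Z^+_M[f]$ (depending on $p$) denotes a chosen function in $D^+[M]$ attaining it, with a chosen representation. Finally $W^{(d)}_L[f](p)=\inf_{M\ge1}\big[\,|||Z^+_M[f]|||\Theta_{p,L}+Q^+_M[f]_p\,\big]$. *)

theory Defs
  imports "HOL-Probability.Probability"
begin

text \<open>
  Multi-indices are extensional functions on \<open>{1..d}\<close>. The spaces \<open>X_s\<close> are a family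
  \<open>\<mu> s\<close> of measures over a common ambient type with possibly different carriers and sigma-algebras;
  \<open>\<xi> s i\<close> is the random variable \<open>\<xi>_i(s)\<close> on the probability space \<open>P\<close>.
\<close>

definition Lp_norm :: "'x measure \<Rightarrow> real \<Rightarrow> ('x \<Rightarrow> real) \<Rightarrow> real" where
  "Lp_norm M p h = (\<integral>x. \<bar>h x\<bar> powr p \<partial>M) powr (1 / p)"

definition Lp_space :: "'x measure \<Rightarrow> real \<Rightarrow> ('x \<Rightarrow> real) set" where
  "Lp_space M p = {h \<in> borel_measurable M. integrable M (\<lambda>x. \<bar>h x\<bar> powr p)}"

definition S_avg ::
  "nat \<Rightarrow> (nat \<Rightarrow> nat \<Rightarrow> 'w \<Rightarrow> 'a) \<Rightarrow> (nat \<Rightarrow> nat) set \<Rightarrow> ((nat \<Rightarrow> 'a) \<Rightarrow> real) \<Rightarrow> 'w \<Rightarrow> real" where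
  "S_avg d \<xi> L f \<omega> = (\<Sum>k\<in>L. f (\<lambda>s\<in>{1..d}. \<xi> s (k s) \<omega>)) / real (card L)"

definition side_lengths :: "nat \<Rightarrow> (nat \<Rightarrow> nat) set" where
  "side_lengths d = {n \<in> extensional {1..d}. \<forall>s\<in>{1..d}. 1 \<le> n s}"

definition box_of :: "nat \<Rightarrow> (nat \<Rightarrow> nat) \<Rightarrow> (nat \<Rightarrow> nat) set" where
  "box_of d n = (\<Pi>\<^sub>E s\<in>{1..d}. {1..n s})"

text \<open>Since \<open>0 powr p = 0\<close> for every real \<open>p\<close>, the term \<open>k = 0\<close> vanishes, as it should for \<open>p > 0\<close>.\<close>

definition bell_fun :: "real \<Rightarrow> real" where
  "bell_fun p = exp (-1) * (\<Sum>k. real k powr p / fact k)"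

definition moment :: "'w measure \<Rightarrow> (nat \<Rightarrow> 'w \<Rightarrow> real) \<Rightarrow> nat \<Rightarrow> real \<Rightarrow> real" where
  "moment P \<zeta> j p = (\<integral>\<omega>. \<zeta> j \<omega> powr p \<partial>P)"

definition A_fun :: "'w measure \<Rightarrow> real \<Rightarrow> nat \<Rightarrow> (nat \<Rightarrow> 'w \<Rightarrow> real) \<Rightarrow> real" where
  "A_fun P p n \<zeta> = (\<Sum>j=1..n. moment P \<zeta> j p powr (1 / p)) / real n"

definition V_fun :: "'w measure \<Rightarrow> real \<Rightarrow> nat \<Rightarrow> (nat \<Rightarrow> 'w \<Rightarrow> real) \<Rightarrow> real" where
  "V_fun P p n \<zeta> = bell_fun p powr (1 / p) *
     max ((\<Sum>j=1..n. moment P \<zeta> j p) powr (1 / p)) (\<Sum>j=1..n. moment P \<zeta> j 1) / real n"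

definition Theta :: "'w measure \<Rightarrow> real \<Rightarrow> nat \<Rightarrow> (nat \<Rightarrow> 'w \<Rightarrow> real) \<Rightarrow> real" where
  "Theta P p n \<zeta> = min (A_fun P p n \<zeta>) (V_fun P p n \<zeta>)"

text \<open>
  The index set \<open>N(k) \<le> M\<close> is \<open>box_of d (\<lambda>_. M)\<close>. The predicate says that \<open>(\<lambda>, g)\<close> is a representation
  of the member \<open>ft\<close> of \<open>D\<^sup>+[M]\<close>.
\<close>

definition Dplus_repr ::
  "nat \<Rightarrow> (nat \<Rightarrow> 'a measure) \<Rightarrow> real \<Rightarrow> nat \<Rightarrow> ((nat \<Rightarrow> 'a) \<Rightarrow> real) \<Rightarrow>
   ((nat \<Rightarrow> nat) \<Rightarrow> real) \<Rightarrow> (nat \<Rightarrow> nat \<Rightarrow> 'a \<Rightarrow> real) \<Rightarrow> bool" where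
  "Dplus_repr d \<mu> p M ft lam g \<longleftrightarrow>
     (\<forall>s\<in>{1..d}. \<forall>k\<in>{1..M}. g s k \<in> Lp_space (\<mu> s) p \<and> (\<forall>x\<in>space (\<mu> s). 0 \<le> g s k x)) \<and>
     (\<forall>x\<in>space (Pi\<^sub>M {1..d} \<mu>).
        0 \<le> ft x \<and>
        ft x = (\<Sum>k\<in>box_of d (\<lambda>_. M). lam k * (\<Prod>s\<in>{1..d}. g s (k s) (x s))))"

definition Dplus :: "nat \<Rightarrow> (nat \<Rightarrow> 'a measure) \<Rightarrow> real \<Rightarrow> nat \<Rightarrow> ((nat \<Rightarrow> 'a) \<Rightarrow> real) set" where
  "Dplus d \<mu> p M = {ft. \<exists>lam g. Dplus_repr d \<mu> p M ft lam g}"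

definition Theta_box ::
  "'w measure \<Rightarrow> (nat \<Rightarrow> nat \<Rightarrow> 'w \<Rightarrow> 'a) \<Rightarrow> nat \<Rightarrow> real \<Rightarrow> (nat \<Rightarrow> nat) \<Rightarrow> nat \<Rightarrow>
   ((nat \<Rightarrow> nat) \<Rightarrow> real) \<Rightarrow> (nat \<Rightarrow> nat \<Rightarrow> 'a \<Rightarrow> real) \<Rightarrow> real" where
  "Theta_box P \<xi> d p n M lam g =
     (\<Sum>k\<in>box_of d (\<lambda>_. M). \<bar>lam k\<bar> *
        (\<Prod>s\<in>{1..d}. Theta P p (n s) (\<lambda>i \<omega>. g s (k s) (\<xi> s i \<omega>))))"

definition Qplus ::
  "nat \<Rightarrow> (nat \<Rightarrow> 'a measure) \<Rightarrow> real \<Rightarrow> nat \<Rightarrow> ((nat \<Rightarrow> 'a) \<Rightarrow> real) \<Rightarrow> real" where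
  "Qplus d \<mu> p M f = (INF ft\<in>Dplus d \<mu> p M. Lp_norm (Pi\<^sub>M {1..d} \<mu>) p (\<lambda>x. f x - ft x))"

text \<open>
  A choice, for each \<open>p\<close> and \<open>M\<close>, of a minimiser \<open>Z p M\<close> in \<open>D\<^sup>+[M]\<close> together with a representation
  \<open>(lam p M, g p M)\<close> of it. Such a choice exists iff the infimum \<open>Q\<^sup>+\<close> is attained.
\<close>

definition optimal_choice ::
  "nat \<Rightarrow> (nat \<Rightarrow> 'a measure) \<Rightarrow> ((nat \<Rightarrow> 'a) \<Rightarrow> real) \<Rightarrow> real set \<Rightarrow>
   (real \<Rightarrow> nat \<Rightarrow> (nat \<Rightarrow> 'a) \<Rightarrow> real) \<Rightarrow> (real \<Rightarrow> nat \<Rightarrow> (nat \<Rightarrow> nat) \<Rightarrow> real) \<Rightarrow>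
   (real \<Rightarrow> nat \<Rightarrow> nat \<Rightarrow> nat \<Rightarrow> 'a \<Rightarrow> real) \<Rightarrow> bool" where
  "optimal_choice d \<mu> f I Z lam g \<longleftrightarrow>
     (\<forall>p\<in>I. \<forall>M\<ge>1. Dplus_repr d \<mu> p M (Z p M) (lam p M) (g p M) \<and>
        Lp_norm (Pi\<^sub>M {1..d} \<mu>) p (\<lambda>x. f x - Z p M x) = Qplus d \<mu> p M f)"

text \<open>\<open>W\<close> depends on the minimisers only through their chosen representations.\<close>

definition W_fun ::
  "'w measure \<Rightarrow> (nat \<Rightarrow> nat \<Rightarrow> 'w \<Rightarrow> 'a) \<Rightarrow> nat \<Rightarrow> (nat \<Rightarrow> 'a measure) \<Rightarrow> ((nat \<Rightarrow> 'a) \<Rightarrow> real) \<Rightarrow>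
   (real \<Rightarrow> nat \<Rightarrow> (nat \<Rightarrow> nat) \<Rightarrow> real) \<Rightarrow> (real \<Rightarrow> nat \<Rightarrow> nat \<Rightarrow> nat \<Rightarrow> 'a \<Rightarrow> real) \<Rightarrow>
   (nat \<Rightarrow> nat) \<Rightarrow> real \<Rightarrow> real" where
  "W_fun P \<xi> d \<mu> f lam g n p =
     (INF M\<in>{1..}. Theta_box P \<xi> d p n M (lam p M) (g p M) + Qplus d \<mu> p M f)"

text \<open>The supremum of \<open>W\<close> over all boxes; meaningful only where it is finite, i.e. for \<open>bdd_above\<close> families.\<close>

definition nu_sup ::
  "'w measure \<Rightarrow> (nat \<Rightarrow> nat \<Rightarrow> 'w \<Rightarrow> 'a) \<Rightarrow> nat \<Rightarrow> (nat \<Rightarrow> 'a measure) \<Rightarrow> ((nat \<Rightarrow> 'a) \<Rightarrow> real) \<Rightarrow>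
   (real \<Rightarrow> nat \<Rightarrow> (nat \<Rightarrow> nat) \<Rightarrow> real) \<Rightarrow> (real \<Rightarrow> nat \<Rightarrow> nat \<Rightarrow> nat \<Rightarrow> 'a \<Rightarrow> real) \<Rightarrow> real \<Rightarrow> real" where
  "nu_sup P \<xi> d \<mu> f lam g p = (SUP n\<in>side_lengths d. W_fun P \<xi> d \<mu> f lam g n p)"

definition p_range :: "ereal \<Rightarrow> real set" where
  "p_range b = {p. 2 \<le> p \<and> ereal p < b}"

text \<open>The library has \<open>ln 0 = 0\<close> on the reals, whereas \<open>ln 0 = -\<infinity>\<close> is required here.\<close>

definition zeta :: "(real \<Rightarrow> real) \<Rightarrow> real \<Rightarrow> ereal" where
  "zeta \<psi> p = (if \<psi> p = 0 then -\<infinity> else ereal (p * ln (\<psi> p)))"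

definition zeta_star :: "ereal \<Rightarrow> (real \<Rightarrow> real) \<Rightarrow> real \<Rightarrow> ereal" where
  "zeta_star b \<psi> u = (SUP p\<in>p_range b. ereal (p * u) - zeta \<psi> p)"

definition exp_ereal :: "ereal \<Rightarrow> ereal" where
  "exp_ereal x = (if x = \<infinity> then \<infinity> else if x = -\<infinity> then 0 else ereal (exp (real_of_ereal x)))"

end

theory Submission
  imports Defs
begin

text \<open>
  Minkowski's inequality splits \<open>S\<^sub>L[f]\<close> into \<open>S\<^sub>L[Z]\<close> and \<open>S\<^sub>L[f - Z]\<close>; the second has norm at most
  \<open>Q\<^sup>+\<close>. For a product function, \<open>S\<^sub>L\<close> factors into independent one-dimensional averages, whose norms
  are bounded by \<open>\<Theta>\<close>. Hence \<open>|S\<^sub>L[f]|\<^sub>p \<le> W(p)\<close>, and Markov's inequality, optimised over \<open>p\<close>, gives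
  the tail bound.

  The deep part of \<open>\<Theta>\<close> is Rosenthal's inequality with the Bell constant: for independent \<open>\<zeta>\<^sub>i \<ge> 0\<close>,
  \<open>p \<ge> 2\<close> and \<open>m\<close> with \<open>\<Sum> E \<zeta>\<^sub>i \<le> m\<close> and \<open>\<Sum> E \<zeta>\<^sub>i\<^sup>p \<le> m\<^sup>p\<close>, the sum is dominated in \<open>p\<close>-th moment by \<open>m\<close>
  times a Poisson variable of mean 1. Since \<open>((s + x)\<^sup>p - s\<^sup>p) / x\<close> is concave and increasing as a function
  of \<open>x\<^bsup>p-1\<^esup>\<close>, the law of \<open>\<zeta>\<^sub>i\<close> may be replaced by a two-point law on \<open>{0, x\<^sub>i}\<close> with the same first and
  \<open>p\<close>-th moments, that law by a Poisson multiple of \<open>x\<^sub>i\<close>, and finally the resulting compound Poisson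
  variable, seen as the exponential of a sum of shift operators, by the one with a single jump size \<open>m\<close>.
\<close>

section \<open>Increments of powers\<close>

text \<open>Convexity of the \<open>k\<close>-th power: with \<open>C = A + B\<close>,
  \<open>u + v\<close> is the convex combination of \<open>u * C / A\<close> and
  \<open>v * C / B\<close> with weights \<open>A / C\<close> and \<open>B / C\<close>. Equality
  holds when \<open>u : v = A : B\<close>, so the weights can be tuned. This serves both the tangent
  line below and Minkowski's inequality.\<close>

lemma powr_add_le_weighted:
  fixes u v A B k :: real
  assumes "1 \<le> k" "0 \<le> u" "0 \<le> v" "0 < A" "0 < B"
  shows "(u + v) powr k \<le> (A + B) powr (k - 1) * (A powr (1 - k) * u powr k + B powr (1 - k) * v powr k)"
proof -
  define C where "C = A + B"
  have C: "0 < C" "A < C" "B < C" using assms by (auto simp: C_def)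
  have wt: "C powr (k - 1) * (a powr (1 - k) * x powr k) = (a / C) * (x * C / a) powr k"
    if "0 < a" "0 \<le> x" for a x
    using that C by (simp add: powr_mult powr_divide powr_diff field_simps)
  \<comment> \<open>Convexity is used on the open half-line, so a vanishing summand is treated
    apart; there \<open>(C / a) powr (k - 1)\<close> is at least 1.\<close>
  have single: "x powr k \<le> C powr (k - 1) * (a powr (1 - k) * x powr k)" if "0 < a" "a \<le> C" for a x :: real
  proof -
    have "1 \<le> (C / a) powr (k - 1)"
      using that assms(1) by (intro ge_one_powr_ge_zero) auto
    also have "\<dots> = C powr (k - 1) * a powr (1 - k)"
      using that C by (simp add: powr_divide powr_diff field_simps)
    finally have "1 * x powr k \<le> (C powr (k - 1) * a powr (1 - k)) * x powr k"
      by (intro mult_right_mono) auto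
    thus ?thesis by (simp add: mult_ac)
  qed
  consider "u = 0" | "v = 0" | "0 < u" "0 < v" using assms by fastforce
  hence "(u + v) powr k \<le> C powr (k - 1) * (A powr (1 - k) * u powr k + B powr (1 - k) * v powr k)"
  proof cases
    case 1 thus ?thesis using single[of B v] assms C by (simp add: powr_zero_eq_one)
  next
    case 2 thus ?thesis using single[of A u] assms C by (simp add: powr_zero_eq_one)
  next
    case 3
    have "convex_on {0<..} (\<lambda>x::real. x powr k)" using powr_convex assms(1) by blast
    hence "((1 - B / C) *\<^sub>R (u * C / A) + (B / C) *\<^sub>R (v * C / B)) powr k
       \<le> (1 - B / C) * (u * C / A) powr k + (B / C) * (v * C / B) powr k"
      using 3 assms C by (intro convex_onD) auto
    moreover have "1 - B / C = A / C" using C by (auto simp: C_def field_simps)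
    moreover have "(A / C) *\<^sub>R (u * C / A) + (B / C) *\<^sub>R (v * C / B) = u + v"
      using C assms by simp
    ultimately have "(u + v) powr k \<le> (A / C) * (u * C / A) powr k + (B / C) * (v * C / B) powr k"
      by simp
    thus ?thesis using wt[of A u] wt[of B v] 3 assms by (simp add: distrib_left)
  qed
  thus ?thesis by (simp add: C_def)
qed

text \<open>This is the tangent line at \<open>X\<^bsup>p-1\<^esup>\<close> of the concave function of \<open>x\<^bsup>p-1\<^esup>\<close> mentioned above. The
  functions \<open>a\<close> and \<open>b\<close> of the proof are antiderivatives in \<open>r\<close> of the coefficients obtained by bounding
  \<open>(s + r * x) powr (p - 1)\<close> with the weights \<open>s\<close> and \<open>r * X\<close>.\<close>

lemma powr_increment_tangent:
  fixes p s X :: real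
  assumes "2 \<le> p" "0 \<le> s" "0 < X"
  shows "\<exists>\<alpha> \<beta>. 0 \<le> \<alpha> \<and> 0 \<le> \<beta> \<and>
    (\<forall>x\<ge>0. (s + x) powr p - s powr p \<le> \<alpha> * x + \<beta> * x powr p) \<and>
    \<alpha> * X + \<beta> * X powr p = (s + X) powr p - s powr p"
proof (cases "s = 0")
  case True
  \<comment> \<open>At \<open>s = 0\<close> the increment is \<open>x powr p\<close> itself.
    Otherwise \<open>s\<close> serves as a weight and has to be positive.\<close>
  thus ?thesis by (intro exI[of _ 0] exI[of _ 1]) auto
next
  case False
  hence s: "0 < s" using assms by auto
  define a where "a r = p * s / ((p - 1) * X) * (s + r * X) powr (p - 1)" for r
  define b where "b r = p * X powr (- p) * ((s + r * X) powr p / p - s * (s + r * X) powr (p - 1) / (p - 1))" for r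
  define a' where "a' r = p * s * (s + r * X) powr (p - 2)" for r
  define b' where "b' r = p * X powr (2 - p) * r * (s + r * X) powr (p - 2)" for r
  have pos: "0 < s + r * x" if "0 \<le> r" "0 \<le> x" for r x
    using that s by (simp add: add_pos_nonneg)
  have da: "(a has_real_derivative a' r) (at r)" if "0 \<le> r" for r
  proof -
    have "(a has_real_derivative p * s / ((p - 1) * X) * ((p - 1) * (s + r * X) powr (p - 2) * X)) (at r)"
      unfolding a_def using pos[of r X] that assms by (auto intro!: derivative_eq_intros)
    thus ?thesis using assms by (simp add: a'_def mult.assoc)
  qed
  have powr1: "(s + r * X) powr (p - 1) = (s + r * X) * (s + r * X) powr (p - 2)" if "0 \<le> r" for r
  proof -
    have "(s + r * X) powr (1 + (p - 2)) = (s + r * X) powr 1 * (s + r * X) powr (p - 2)"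
      by (rule powr_add)
    thus ?thesis using pos[of r X] that assms by simp
  qed
  have XX: "X powr (2 - p) = X * X * X powr (- p)"
  proof -
    have "X powr (2 + (- p)) = X powr 2 * X powr (-p)" by (rule powr_add)
    thus ?thesis using assms by (simp add: power2_eq_square)
  qed
  have db: "(b has_real_derivative b' r) (at r)" if "0 \<le> r" for r
  proof -
    have "(b has_real_derivative
       p * X powr (-p) * (p * (s + r * X) powr (p - 1) * X / p
          - s * ((p - 1) * (s + r * X) powr (p - 2) * X) / (p - 1))) (at r)"
      unfolding b_def
      using pos[of r X] that assms
      by (auto intro!: derivative_eq_intros)
    also have "p * X powr (-p) * (p * (s + r * X) powr (p - 1) * X / p
          - s * ((p - 1) * (s + r * X) powr (p - 2) * X) / (p - 1))
       = p * X powr (-p) * (X * (s + r * X) powr (p - 1) - s * X * (s + r * X) powr (p - 2))"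
      using assms by simp
    also have "\<dots> = b' r"
      unfolding b'_def powr1[OF that] XX by (simp add: algebra_simps)
    finally show ?thesis .
  qed
  have mono: "h 0 \<le> h 1" if "\<And>r. 0 \<le> r \<Longrightarrow> r \<le> 1 \<Longrightarrow> (h has_real_derivative h' r) (at r)"
      "\<And>r. 0 \<le> r \<Longrightarrow> r \<le> 1 \<Longrightarrow> 0 \<le> h' r" for h h' :: "real \<Rightarrow> real"
    using DERIV_nonneg_imp_nondecreasing[of 0 1 h] that by force
  define \<alpha> where "\<alpha> = a 1 - a 0"
  define \<beta> where "\<beta> = b 1 - b 0"
  have "0 \<le> \<alpha>" unfolding \<alpha>_def using mono[of a a'] da assms by (auto simp: a'_def)
  moreover have "0 \<le> \<beta>" unfolding \<beta>_def using mono[of b b'] db assms by (auto simp: b'_def)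
  moreover have "(s + x) powr p - s powr p \<le> \<alpha> * x + \<beta> * x powr p" if x: "0 \<le> x" for x
  proof -
    \<comment> \<open>The increment is the integral over \<open>r\<close> from 0 to 1 of
      \<open>p * x * (s + r * x) powr (p - 1)\<close>. Monotonicity of \<open>?D\<close> replaces
      the comparison of integrals.\<close>
    let ?D = "\<lambda>r. x * a r + x powr p * b r - (s + r * x) powr p"
    let ?D' = "\<lambda>r. x * a' r + x powr p * b' r - p * x * (s + r * x) powr (p - 1)"
    have "?D 0 \<le> ?D 1"
    proof (rule mono[of ?D ?D'])
      fix r :: real assume r: "0 \<le> r" "r \<le> 1"
      show "(?D has_real_derivative ?D' r) (at r)"
        using da db r pos[of r x] x
        by (auto intro!: derivative_eq_intros)
      \<comment> \<open>The weighted inequality with exponent \<open>p - 1\<close>, which is at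
        least 1 as \<open>2 \<le> p\<close>. At \<open>r = 0\<close> the weight \<open>r * X\<close>
        vanishes, so that case is checked directly.\<close>
      have k: "(s + r * x) powr (p - 1)
          \<le> (s + r * X) powr (p - 2) * (s + r * X powr (2 - p) * x powr (p - 1))"
      proof (cases "r = 0")
        case True
        thus ?thesis using powr1[of 0] by simp
      next
        case False
        hence r0: "0 < r" using r by simp
        have e1: "s powr (2 - p) * s powr (p - 1) = s" using s by (simp flip: powr_add)
        have e2: "(r * X) powr (2 - p) * (r * x) powr (p - 1) = r * X powr (2 - p) * x powr (p - 1)"
        proof -
          have "r powr (2 - p) * r powr (p - 1) = r" using r0 by (simp flip: powr_add)
          thus ?thesis using r0 x assms by (simp add: powr_mult mult_ac)
        qed
        have "1 \<le> p - 1" "0 \<le> s" "0 \<le> r * x" "0 < s" "0 < r * X"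
          using r0 x s assms by auto
        from powr_add_le_weighted[OF this] show ?thesis
          using e1 e2 by simp
      qed
      have "x * x powr (p - 1) = x powr p"
        using x assms powr_add[of x 1 "p - 1"] by (cases "x = 0") auto
      hence "x * a' r + x powr p * b' r
        = p * x * ((s + r * X) powr (p - 2) * (s + r * X powr (2 - p) * x powr (p - 1)))"
        unfolding a'_def b'_def by (simp add: algebra_simps)
      moreover have "p * x * (s + r * x) powr (p - 1)
        \<le> p * x * ((s + r * X) powr (p - 2) * (s + r * X powr (2 - p) * x powr (p - 1)))"
        using k x assms by (intro mult_left_mono) auto
      ultimately show "0 \<le> ?D' r" by simp
    qed
    thus ?thesis by (simp add: \<alpha>_def \<beta>_def algebra_simps)
  qed
  \<comment> \<open>At \<open>x = X\<close> the weights equal the summands \<open>s\<close> and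
    \<open>r * X\<close>, so no loss occurs; the equality is verified on the closed forms.\<close>
  moreover have "\<alpha> * X + \<beta> * X powr p = (s + X) powr p - s powr p"
  proof -
    have "\<alpha> * X = p * s / (p - 1) * ((s + X) powr (p - 1) - s powr (p - 1))"
      using assms by (simp add: \<alpha>_def a_def diff_divide_distrib[symmetric] right_diff_distrib[symmetric] del: right_diff_distrib)
    moreover have "\<beta> * X powr p = p * (((s + X) powr p - s powr p) / p
        - s * ((s + X) powr (p - 1) - s powr (p - 1)) / (p - 1))"
    proof -
      have "\<beta> * X powr p = (X powr (-p) * X powr p) * (p * (((s + X) powr p / p - s * (s + X) powr (p - 1) / (p - 1))
          - (s powr p / p - s * s powr (p - 1) / (p - 1))))"
      proof -
        have "(c * e * a1 - c * e * a0) * z = (e * z) * (c * (a1 - a0))" for c e a1 a0 z :: real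
          by (simp add: algebra_simps)
        thus ?thesis unfolding \<beta>_def b_def by simp
      qed
      also have "X powr (-p) * X powr p = 1" using assms by (simp flip: powr_add)
      finally show ?thesis by (simp add: right_diff_distrib diff_divide_distrib)
    qed
    ultimately show ?thesis using assms by (simp add: algebra_simps diff_divide_distrib)
  qed
  ultimately show ?thesis by blast
qed

section \<open>Exponentials of shift operators\<close>

text \<open>A list of pairs \<open>(w, x)\<close> stands for the measure \<open>\<Sum> w \<delta>\<^sub>x\<close>; for nonnegative \<open>w\<close>, \<open>exp_op\<close> is then
  \<open>exp (\<Sum> w)\<close> times the expectation over the compound Poisson law with this jump measure.\<close>

fun shift_op :: "(real \<times> real) list \<Rightarrow> (real \<Rightarrow> ennreal) \<Rightarrow> real \<Rightarrow> ennreal" where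
  "shift_op [] \<phi> s = 0"
| "shift_op ((w, x) # l) \<phi> s = ennreal w * \<phi> (s + x) + shift_op l \<phi> s"

definition exp_op :: "(real \<times> real) list \<Rightarrow> (real \<Rightarrow> ennreal) \<Rightarrow> real \<Rightarrow> ennreal" where
  "exp_op l \<phi> s = (\<Sum>k. ennreal (1 / fact k) * (shift_op l ^^ k) \<phi> s)"

section \<open>Algebra of shift operators\<close>

lemma shift_op_append: "shift_op (l @ m) \<phi> s = shift_op l \<phi> s + shift_op m \<phi> s"
  by (induction l \<phi> s rule: shift_op.induct) (auto simp: add_ac)

lemma shift_op_add: "shift_op l (\<lambda>s. \<phi> s + \<psi> s) s = shift_op l \<phi> s + shift_op l \<psi> s"
  by (induction l \<phi> s rule: shift_op.induct) (auto simp: algebra_simps)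

lemma shift_op_cmult: "shift_op l (\<lambda>s. c * \<phi> s) s = c * shift_op l \<phi> s"
  by (induction l \<phi> s rule: shift_op.induct) (auto simp: algebra_simps)

lemma shift_op_suminf: "shift_op l (\<lambda>s. \<Sum>n. \<phi> n s) s = (\<Sum>n. shift_op l (\<phi> n) s)"
proof (induction l)
  case (Cons a l)
  thus ?case by (cases a) (simp add: suminf_add[symmetric])
qed simp

lemma shift_op_shift: "shift_op l (\<lambda>s. \<phi> (s + x)) s = shift_op l \<phi> (s + x)"
  by (induction l \<phi> s rule: shift_op.induct) (auto simp: add_ac)

lemma shift_op_commute: "shift_op l (shift_op m \<phi>) s = shift_op m (shift_op l \<phi>) s"
proof (induction l)
  case Nil
  show ?case by (induction m) auto
next
  case (Cons a l)
  obtain w x where a: "a = (w, x)" by (cases a)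
  have "shift_op (a # l) \<phi> = (\<lambda>s. ennreal w * \<phi> (s + x) + shift_op l \<phi> s)"
    by (auto simp: a)
  hence "shift_op m (shift_op (a # l) \<phi>) s
      = shift_op m (\<lambda>s. ennreal w * \<phi> (s + x) + shift_op l \<phi> s) s"
    by (rule arg_cong)
  also have "\<dots> = ennreal w * shift_op m \<phi> (s + x) + shift_op m (shift_op l \<phi>) s"
    by (simp add: shift_op_add shift_op_cmult shift_op_shift)
  finally show ?case using Cons by (simp add: a del: shift_op.simps) (simp add: a)
qed

text \<open>Pointwise bounds will be known on the half-line only; nonnegative jumps never leave
  it.\<close>

lemma shift_op_mono:
  assumes "\<And>t. 0 \<le> t \<Longrightarrow> \<phi> t \<le> \<psi> t" "0 \<le> s" "\<And>w x. (w, x) \<in> set l \<Longrightarrow> 0 \<le> x"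
  shows "shift_op l \<phi> s \<le> shift_op l \<psi> s"
  using assms(3)
proof (induction l)
  case (Cons a l)
  obtain w x where a: "a = (w, x)" by (cases a)
  have "0 \<le> x" using Cons.prems[of w x] a by simp
  hence "\<phi> (s + x) \<le> \<psi> (s + x)" using assms by auto
  moreover have "shift_op l \<phi> s \<le> shift_op l \<psi> s" using Cons by auto
  ultimately show ?case by (auto simp: a intro!: add_mono mult_left_mono)
qed simp

lemma funpow_commute_shift_op:
  "shift_op m ((shift_op l ^^ k) \<phi>) = (shift_op l ^^ k) (shift_op m \<phi>)"
proof (induction k)
  case (Suc k)
  have "shift_op m ((shift_op l ^^ Suc k) \<phi>) = shift_op l (shift_op m ((shift_op l ^^ k) \<phi>))"
    using shift_op_commute by (auto intro!: ext)
  thus ?case using Suc by simp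
qed simp

lemma funpow_shift_op_cmult:
  "(shift_op l ^^ k) (\<lambda>s. c * \<phi> s) s = c * (shift_op l ^^ k) \<phi> s"
proof (induction k arbitrary: s)
  case (Suc k)
  have "(shift_op l ^^ k) (\<lambda>s. c * \<phi> s) = (\<lambda>s. c * (shift_op l ^^ k) \<phi> s)"
    using Suc by auto
  thus ?case by (simp add: shift_op_cmult)
qed simp

lemma funpow_shift_op_suminf:
  "(shift_op l ^^ k) (\<lambda>s. \<Sum>n. \<phi> n s) s = (\<Sum>n. (shift_op l ^^ k) (\<phi> n) s)"
proof (induction k arbitrary: s)
  case (Suc k)
  have "(shift_op l ^^ k) (\<lambda>s. \<Sum>n. \<phi> n s) = (\<lambda>s. \<Sum>n. (shift_op l ^^ k) (\<phi> n) s)"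
    using Suc by auto
  thus ?case by (simp add: shift_op_suminf)
qed simp

text \<open>Stated for an abstract array so that the binomial theorem applies to commuting operators on a
  function space, which is not an instance of a ring class.\<close>

lemma binomial_recurrence:
  fixes c :: "nat \<Rightarrow> nat \<Rightarrow> nat \<Rightarrow> 'a::comm_semiring_1"
  assumes "\<And>n i j. c (Suc n) i j = c n (Suc i) j + c n i (Suc j)"
  shows "c n i j = (\<Sum>k\<le>n. of_nat (n choose k) * c 0 (i + k) (j + (n - k)))"
proof (induction n arbitrary: i j)
  case (Suc n)
  have "(\<Sum>k\<le>Suc n. of_nat (Suc n choose k) * c 0 (i + k) (j + (Suc n - k)))
      = c 0 i (j + Suc n) + (\<Sum>k\<le>n. of_nat (Suc n choose Suc k) * c 0 (i + Suc k) (j + (n - k)))"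
    by (subst sum.atMost_Suc_shift) simp
  also have "\<dots> = (\<Sum>k\<le>n. of_nat (n choose k) * c 0 (i + Suc k) (j + (n - k)))
     + (c 0 i (j + Suc n) + (\<Sum>k\<le>n. of_nat (n choose Suc k) * c 0 (i + Suc k) (j + (n - k))))"
    by (simp add: algebra_simps sum.distrib)
  also have "c 0 i (j + Suc n) + (\<Sum>k\<le>n. of_nat (n choose Suc k) * c 0 (i + Suc k) (j + (n - k)))
     = (\<Sum>k\<le>Suc n. of_nat (n choose k) * c 0 (i + k) (j + (Suc n - k)))"
    by (subst sum.atMost_Suc_shift) simp
  \<comment> \<open>The summand \<open>k = Suc n\<close> drops out because
    \<open>n choose Suc n\<close> is zero.\<close>
  also have "\<dots> = (\<Sum>k\<le>n. of_nat (n choose k) * c 0 (i + k) (Suc j + (n - k)))"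
    by (simp add: Suc_diff_le binomial_eq_0 del: add_diff_assoc cong: sum.cong_simp)
  also have "(\<Sum>k\<le>n. of_nat (n choose k) * c 0 (i + Suc k) (j + (n - k))) + \<dots> = c (Suc n) i j"
    unfolding assms using Suc[of "Suc i" j] Suc[of i "Suc j"] by simp
  finally show ?case by simp
qed simp

lemma shift_op_append_power:
  "(shift_op (l @ m) ^^ n) \<phi> s
     = (\<Sum>k\<le>n. of_nat (n choose k) * (shift_op l ^^ k) ((shift_op m ^^ (n - k)) \<phi>) s)"
proof -
  \<comment> \<open>The joint operator is applied \<open>n\<close> times after \<open>i\<close>
    copies of one operator and \<open>j\<close> of the other. By commutativity one joint factor
    moves inside and splits, which raises \<open>i\<close> or \<open>j\<close> by one.\<close>
  define c where
    "c n i j = (shift_op (l @ m) ^^ n) ((shift_op l ^^ i) ((shift_op m ^^ j) \<phi>)) s" for n i j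
  have "c (Suc n) i j = c n (Suc i) j + c n i (Suc j)" for n i j
  proof -
    let ?\<psi> = "(shift_op l ^^ i) ((shift_op m ^^ j) \<phi>)"
    have "c (Suc n) i j = shift_op (l @ m) ((shift_op (l @ m) ^^ n) ?\<psi>) s" by (simp add: c_def)
    also have "\<dots> = (shift_op (l @ m) ^^ n) (shift_op l ?\<psi>) s + (shift_op (l @ m) ^^ n) (shift_op m ?\<psi>) s"
      by (simp only: funpow_commute_shift_op[of "l @ m" n "l @ m", symmetric] shift_op_append
            funpow_commute_shift_op[of l n "l @ m", symmetric] funpow_commute_shift_op[of m n "l @ m", symmetric])
    also have "shift_op m ?\<psi> = (shift_op l ^^ i) ((shift_op m ^^ Suc j) \<phi>)"
      by (simp add: funpow_commute_shift_op)
    finally show ?thesis by (simp add: c_def)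
  qed
  from binomial_recurrence[of c n 0 0, OF this] show ?thesis
    by (simp add: c_def)
qed

text \<open>Padding row \<open>i\<close> with \<open>i\<close> leading zeros turns diagonals into
  columns; Tonelli for the counting measure then exchanges the sums.\<close>

lemma suminf_ennreal_diagonal:
  fixes f :: "nat \<Rightarrow> nat \<Rightarrow> ennreal"
  shows "(\<Sum>i. \<Sum>j. f i j) = (\<Sum>n. \<Sum>i\<le>n. f i (n - i))"
proof -
  have "(\<Sum>j. f i j) = (\<Sum>n. if i \<le> n then f i (n - i) else 0)" for i
  proof -
    \<comment> \<open>The amount of padding \<open>k\<close> is decoupled from the row
      \<open>i\<close> to allow induction on it.\<close>
    have "(\<lambda>n. if k \<le> n then f i (n - k) else 0) sums (\<Sum>j. f i j)" for k
    proof (induction k)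
      case (Suc k)
      thus ?case using sums_Suc[of "\<lambda>n. if Suc k \<le> n then f i (n - Suc k) else 0" "\<Sum>j. f i j"]
        by (simp cong: if_cong)
    qed (simp add: summable_sums)
    thus ?thesis by (simp add: sums_iff)
  qed
  hence "(\<Sum>i. \<Sum>j. f i j) = (\<Sum>i. \<Sum>n. if i \<le> n then f i (n - i) else 0)"
    by (simp only:)
  also have "\<dots> = (\<integral>\<^sup>+i. (\<Sum>n. if i \<le> n then f i (n - i) else 0) \<partial>count_space UNIV)"
    by (rule nn_integral_count_space_nat[symmetric])
  also have "\<dots> = (\<Sum>n. \<integral>\<^sup>+i. (if i \<le> n then f i (n - i) else 0) \<partial>count_space UNIV)"
    by (rule nn_integral_suminf) simp
  also have "\<dots> = (\<Sum>n. \<Sum>i. if i \<le> n then f i (n - i) else 0)"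
    by (simp only: nn_integral_count_space_nat)
  also have "\<dots> = (\<Sum>n. \<Sum>i\<le>n. f i (n - i))"
  proof (intro arg_cong[of _ _ suminf] ext)
    fix n
    have "(\<Sum>i. if i \<le> n then f i (n - i) else 0) = (\<Sum>i\<le>n. if i \<le> n then f i (n - i) else 0)"
      by (rule suminf_finite) auto
    thus "(\<Sum>i. if i \<le> n then f i (n - i) else 0) = (\<Sum>i\<le>n. f i (n - i))"
      by simp
  qed
  finally show ?thesis .
qed

text \<open>For commuting operators the Cauchy product of the two exponential series is regrouped by
  the binomial theorem. In probabilistic terms, adding independent compound Poisson variables joins
  their jump measures.\<close>

lemma exp_op_append: "exp_op (l @ m) \<phi> s = exp_op l (exp_op m \<phi>) s"
proof -
  have "exp_op l (exp_op m \<phi>) s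
     = (\<Sum>i. ennreal (1 / fact i) * (shift_op l ^^ i) (\<lambda>s. \<Sum>j. ennreal (1 / fact j) * (shift_op m ^^ j) \<phi> s) s)"
    unfolding exp_op_def[abs_def] ..
  also have "\<dots> = (\<Sum>i. \<Sum>j. ennreal (1 / fact i) * (ennreal (1 / fact j) * (shift_op l ^^ i) ((shift_op m ^^ j) \<phi>) s))"
    by (simp only: funpow_shift_op_suminf funpow_shift_op_cmult ennreal_suminf_cmult)
  also have "\<dots> = (\<Sum>n. \<Sum>i\<le>n. ennreal (1 / fact i) * (ennreal (1 / fact (n - i)) * (shift_op l ^^ i) ((shift_op m ^^ (n - i)) \<phi>) s))"
    by (rule suminf_ennreal_diagonal)
  also have "\<dots> = (\<Sum>n. ennreal (1 / fact n) * (shift_op (l @ m) ^^ n) \<phi> s)"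
  proof (intro arg_cong[of _ _ suminf] ext)
    fix n
    have "ennreal (1 / fact i) * (ennreal (1 / fact (n - i)) * a) = ennreal (1 / fact n) * (of_nat (n choose i) * a)"
      if "i \<le> n" for i a
    proof -
      have "1 / fact i * (1 / fact (n - i)) = 1 / fact n * real (n choose i)"
        using that by (simp add: binomial_fact)
      hence "ennreal (1 / fact i) * ennreal (1 / fact (n - i)) = ennreal (1 / fact n) * of_nat (n choose i)"
        by (simp add: ennreal_of_nat_eq_real_of_nat ennreal_mult[symmetric])
      thus ?thesis by (simp add: mult.assoc[symmetric])
    qed
    thus "(\<Sum>i\<le>n. ennreal (1 / fact i) * (ennreal (1 / fact (n - i)) * (shift_op l ^^ i) ((shift_op m ^^ (n - i)) \<phi>) s))
        = ennreal (1 / fact n) * (shift_op (l @ m) ^^ n) \<phi> s"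
      unfolding shift_op_append_power sum_distrib_left by (intro sum.cong) auto
  qed
  finally show ?thesis by (simp add: exp_op_def)
qed

section \<open>A single jump size\<close>

lemma funpow_shift_op_single:
  assumes "0 \<le> w"
  shows "(shift_op [(w, x)] ^^ k) \<phi> s = ennreal (w ^ k) * \<phi> (s + real k * x)"
proof (induction k arbitrary: s)
  case (Suc k)
  show ?case using Suc[of "s + x"] assms
    by (simp add: ennreal_mult mult.assoc algebra_simps)
qed simp

text \<open>Up to the factor \<open>exp (- w)\<close> this is the expectation of
  \<open>\<phi> (s + N * x)\<close> for a Poisson variable \<open>N\<close> of mean
  \<open>w\<close>.\<close>

lemma exp_op_single:
  assumes "0 \<le> w"
  shows "exp_op [(w, x)] \<phi> s = (\<Sum>k. ennreal (w ^ k / fact k) * \<phi> (s + real k * x))"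
proof -
  have "ennreal (1 / fact k) * (ennreal (w ^ k) * a) = ennreal (w ^ k / fact k) * a" for k a
    using assms ennreal_mult[of "1 / fact k" "w ^ k"] by (simp flip: mult.assoc)
  thus ?thesis unfolding exp_op_def funpow_shift_op_single[OF assms] by simp
qed

lemma suminf_ennreal_exp:
  assumes "0 \<le> w"
  shows "(\<Sum>k. ennreal (w ^ k / fact k)) = ennreal (exp w)"
proof -
  have *: "(\<lambda>k. w ^ k / fact k) sums exp w"
    using exp_converges[of w] by (simp add: field_simps)
  have "(\<Sum>k. ennreal (w ^ k / fact k)) = ennreal (\<Sum>k. w ^ k / fact k)"
    using assms sums_summable[OF *] by (intro suminf_ennreal2) auto
  thus ?thesis using sums_unique[OF *] by simp
qed

lemma exp_op_zero_shift:
  assumes "0 \<le> w"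
  shows "exp_op [(w, 0)] \<phi> s = ennreal (exp w) * \<phi> s"
  by (simp only: exp_op_single[OF assms] mult_zero_right add_0_right ennreal_suminf_multc suminf_ennreal_exp[OF assms])

section \<open>Comparison of compound Poisson laws\<close>

definition nonneg_list :: "(real \<times> real) list \<Rightarrow> bool" where
  "nonneg_list l \<longleftrightarrow> (\<forall>(w, x)\<in>set l. 0 \<le> w \<and> 0 \<le> x)"

abbreviation total_weight :: "(real \<times> real) list \<Rightarrow> real" where
  "total_weight l \<equiv> (\<Sum>(w, x)\<leftarrow>l. w)"

text \<open>The measure with mass \<open>Q\<close> at the single point \<open>X\<close> has at least
  the first and \<open>p\<close>-th moments of \<open>l\<close>. Total masses are left free because
  a jump of size 0 has no increment.\<close>

definition jump_bounded :: "real \<Rightarrow> (real \<times> real) list \<Rightarrow> real \<Rightarrow> real \<Rightarrow> bool" where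
  "jump_bounded p l Q X \<longleftrightarrow> nonneg_list l \<and> 0 \<le> Q \<and> 0 < X \<and>
     (\<Sum>(w, x)\<leftarrow>l. w * x) \<le> Q * X \<and> (\<Sum>(w, x)\<leftarrow>l. w * x powr p) \<le> Q * X powr p"

text \<open>In subtraction-free form, which is closed under infinite sums in \<open>ennreal\<close>: the sum of the
  increments \<open>w (\<phi> (s + x) - \<phi> s)\<close> over \<open>l\<close> is at most \<open>Q (\<phi> (s + X) - \<phi> s)\<close>.\<close>

definition dominating :: "real \<Rightarrow> (real \<Rightarrow> ennreal) \<Rightarrow> bool" where
  "dominating p \<phi> \<longleftrightarrow> (\<forall>l Q X s. jump_bounded p l Q X \<and> 0 \<le> s \<longrightarrow>
     shift_op l \<phi> s + ennreal Q * \<phi> s \<le> ennreal Q * \<phi> (s + X) + ennreal (total_weight l) * \<phi> s)"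

lemma nonneg_list_simps [simp]:
  "nonneg_list []" "nonneg_list ((w, x) # l) \<longleftrightarrow> 0 \<le> w \<and> 0 \<le> x \<and> nonneg_list l"
  "nonneg_list (l @ m) \<longleftrightarrow> nonneg_list l \<and> nonneg_list m"
  by (auto simp: nonneg_list_def)

lemma total_weight_nonneg: "nonneg_list l \<Longrightarrow> 0 \<le> total_weight l"
  by (induction l) auto

lemma dominatingD:
  "dominating p \<phi> \<Longrightarrow> jump_bounded p l Q X \<Longrightarrow> 0 \<le> s \<Longrightarrow>
     shift_op l \<phi> s + ennreal Q * \<phi> s \<le> ennreal Q * \<phi> (s + X) + ennreal (total_weight l) * \<phi> s"
  unfolding dominating_def by blast

text \<open>Each increment is bounded by the tangent line at \<open>X\<close>. Its coefficients are
  nonnegative, so the two moment bounds apply, and it is exact at \<open>X\<close>.\<close>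

lemma dominating_powr:
  assumes "2 \<le> p"
  shows "dominating p (\<lambda>t. ennreal (t powr p))"
  unfolding dominating_def
proof (intro allI impI)
  fix l :: "(real \<times> real) list" and Q X s :: real
  assume "jump_bounded p l Q X \<and> 0 \<le> s"
  hence jb: "nonneg_list l" "0 \<le> Q" "0 < X" "0 \<le> s"
     "(\<Sum>(w, x)\<leftarrow>l. w * x) \<le> Q * X" "(\<Sum>(w, x)\<leftarrow>l. w * x powr p) \<le> Q * X powr p"
    by (auto simp: jump_bounded_def)
  obtain \<alpha> \<beta> where ab: "0 \<le> \<alpha>" "0 \<le> \<beta>"
      "\<And>x. 0 \<le> x \<Longrightarrow> (s + x) powr p - s powr p \<le> \<alpha> * x + \<beta> * x powr p"
      "\<alpha> * X + \<beta> * X powr p = (s + X) powr p - s powr p"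
    using powr_increment_tangent[OF assms \<open>0 \<le> s\<close> \<open>0 < X\<close>] by blast
  have sop: "shift_op l (\<lambda>t. ennreal (t powr p)) s = ennreal (\<Sum>(w, x)\<leftarrow>l. w * (s + x) powr p)
      \<and> 0 \<le> (\<Sum>(w, x)\<leftarrow>l. w * (s + x) powr p)"
    using jb(1)
  proof (induction l)
    case (Cons a l)
    thus ?case by (cases a) (auto simp: ennreal_mult ennreal_plus)
  qed simp
  have "(\<Sum>(w, x)\<leftarrow>l. w * (s + x) powr p)
      \<le> total_weight l * s powr p + \<alpha> * (\<Sum>(w, x)\<leftarrow>l. w * x) + \<beta> * (\<Sum>(w, x)\<leftarrow>l. w * x powr p)"
    using jb(1)
  proof (induction l)
    case (Cons a l)
    obtain w x where a: "a = (w, x)" by (cases a)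
    have "w * (s + x) powr p \<le> w * (s powr p + (\<alpha> * x + \<beta> * x powr p))"
      using ab(3)[of x] Cons.prems a by (intro mult_left_mono) auto
    thus ?case using Cons by (simp add: a algebra_simps)
  qed simp
  also have "\<dots> \<le> total_weight l * s powr p + \<alpha> * (Q * X) + \<beta> * (Q * X powr p)"
    using mult_left_mono[OF jb(5) ab(1)] mult_left_mono[OF jb(6) ab(2)] by simp
  also have "\<alpha> * (Q * X) + \<beta> * (Q * X powr p) = Q * (\<alpha> * X + \<beta> * X powr p)"
    by (simp add: algebra_simps)
  hence "total_weight l * s powr p + \<alpha> * (Q * X) + \<beta> * (Q * X powr p)
      = total_weight l * s powr p + Q * ((s + X) powr p - s powr p)"
    unfolding ab(4) by simp
  finally have "(\<Sum>(w, x)\<leftarrow>l. w * (s + x) powr p) + Q * s powr p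
      \<le> Q * (s + X) powr p + total_weight l * s powr p"
    by (simp add: algebra_simps)
  thus "shift_op l (\<lambda>t. ennreal (t powr p)) s + ennreal Q * ennreal (s powr p)
      \<le> ennreal Q * ennreal ((s + X) powr p) + ennreal (total_weight l) * ennreal (s powr p)"
    using sop jb total_weight_nonneg[OF jb(1)]
    by (simp add: ennreal_mult[symmetric] ennreal_plus[symmetric] del: ennreal_plus)
qed

section \<open>Closure properties of \<open>dominating\<close>\<close>

lemma dominating_shift:
  assumes "dominating p \<phi>" "0 \<le> x"
  shows "dominating p (\<lambda>t. \<phi> (t + x))"
  unfolding dominating_def
proof (intro allI impI)
  fix l and Q X s :: real assume a: "jump_bounded p l Q X \<and> 0 \<le> s"
  have "shift_op l \<phi> (s + x) + ennreal Q * \<phi> (s + x)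
      \<le> ennreal Q * \<phi> (s + x + X) + ennreal (total_weight l) * \<phi> (s + x)"
    using assms a by (intro dominatingD) auto
  thus "shift_op l (\<lambda>t. \<phi> (t + x)) s + ennreal Q * \<phi> (s + x)
      \<le> ennreal Q * \<phi> (s + X + x) + ennreal (total_weight l) * \<phi> (s + x)"
    by (simp add: shift_op_shift add_ac)
qed

lemma dominating_cmult:
  assumes "dominating p \<phi>"
  shows "dominating p (\<lambda>t. c * \<phi> t)"
  unfolding dominating_def
proof (intro allI impI)
  fix l and Q X s :: real assume a: "jump_bounded p l Q X \<and> 0 \<le> s"
  have "c * (shift_op l \<phi> s + ennreal Q * \<phi> s)
      \<le> c * (ennreal Q * \<phi> (s + X) + ennreal (total_weight l) * \<phi> s)"
    using assms a by (intro mult_left_mono dominatingD) auto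
  thus "shift_op l (\<lambda>t. c * \<phi> t) s + ennreal Q * (c * \<phi> s)
      \<le> ennreal Q * (c * \<phi> (s + X)) + ennreal (total_weight l) * (c * \<phi> s)"
    by (simp add: shift_op_cmult algebra_simps)
qed

lemma dominating_add:
  assumes "dominating p \<phi>" "dominating p \<psi>"
  shows "dominating p (\<lambda>t. \<phi> t + \<psi> t)"
  unfolding dominating_def
proof (intro allI impI)
  fix l and Q X s :: real assume a: "jump_bounded p l Q X \<and> 0 \<le> s"
  have "(shift_op l \<phi> s + ennreal Q * \<phi> s) + (shift_op l \<psi> s + ennreal Q * \<psi> s)
      \<le> (ennreal Q * \<phi> (s + X) + ennreal (total_weight l) * \<phi> s)
        + (ennreal Q * \<psi> (s + X) + ennreal (total_weight l) * \<psi> s)"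
    using assms a by (intro add_mono dominatingD) auto
  thus "shift_op l (\<lambda>t. \<phi> t + \<psi> t) s + ennreal Q * (\<phi> s + \<psi> s)
      \<le> ennreal Q * (\<phi> (s + X) + \<psi> (s + X)) + ennreal (total_weight l) * (\<phi> s + \<psi> s)"
    by (simp add: shift_op_add algebra_simps)
qed

lemma dominating_suminf:
  assumes "\<And>n::nat. dominating p (\<phi> n)"
  shows "dominating p (\<lambda>t. \<Sum>n. \<phi> n t)"
  unfolding dominating_def
proof (intro allI impI)
  fix l and Q X s :: real assume a: "jump_bounded p l Q X \<and> 0 \<le> s"
  have "(\<Sum>n. shift_op l (\<phi> n) s + ennreal Q * \<phi> n s)
      \<le> (\<Sum>n. ennreal Q * \<phi> n (s + X) + ennreal (total_weight l) * \<phi> n s)"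
    using assms a by (intro suminf_le dominatingD) auto
  thus "shift_op l (\<lambda>t. \<Sum>n. \<phi> n t) s + ennreal Q * (\<Sum>n. \<phi> n s)
      \<le> ennreal Q * (\<Sum>n. \<phi> n (s + X)) + ennreal (total_weight l) * (\<Sum>n. \<phi> n s)"
    by (simp add: shift_op_suminf suminf_add[symmetric])
qed

lemma dominating_zero: "dominating p (\<lambda>_. 0)"
proof -
  have "shift_op l (\<lambda>_. 0) s = 0" for l s by (induction l) auto
  thus ?thesis by (simp add: dominating_def)
qed

lemma dominating_shift_op:
  assumes "dominating p \<phi>" "nonneg_list l"
  shows "dominating p (shift_op l \<phi>)"
  using assms(2)
proof (induction l)
  case Nil
  have "shift_op [] \<phi> = (\<lambda>_. 0)" by auto
  thus ?case by (simp add: dominating_zero)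
next
  case (Cons a l)
  obtain w x where a: "a = (w, x)" by (cases a)
  have "shift_op (a # l) \<phi> = (\<lambda>t. ennreal w * \<phi> (t + x) + shift_op l \<phi> t)" by (auto simp: a)
  thus ?case using Cons assms by (auto simp: a intro!: dominating_add dominating_cmult dominating_shift)
qed

lemma dominating_funpow_shift_op:
  assumes "dominating p \<phi>" "nonneg_list l"
  shows "dominating p ((shift_op l ^^ k) \<phi>)"
  using assms by (induction k) (auto intro: dominating_shift_op)

text \<open>Allows a further variable to be replaced while the others are already represented by a
  compound Poisson law.\<close>

lemma dominating_exp_op:
  assumes "dominating p \<phi>" "nonneg_list l"
  shows "dominating p (exp_op l \<phi>)"
  unfolding exp_op_def[abs_def]
  by (intro dominating_suminf dominating_cmult dominating_funpow_shift_op assms)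

text \<open>The extremal jump measure is a single atom. Comparing generators suffices, since the
  inequality passes to all powers and hence to the exponential series.\<close>

lemma exp_op_compare:
  assumes "dominating p \<phi>" "jump_bounded p l Q X" "0 \<le> s"
  shows "ennreal (exp (- total_weight l)) * exp_op l \<phi> s \<le> ennreal (exp (- Q)) * exp_op [(Q, X)] \<phi> s"
proof -
  have jb: "nonneg_list l" "0 \<le> Q" "0 < X" using assms(2) by (auto simp: jump_bounded_def)
  let ?W = "total_weight l"
  have W: "0 \<le> ?W" by (rule total_weight_nonneg[OF jb(1)])
  \<comment> \<open>Zero jumps only rescale \<open>exp_op\<close>. Padding with them turns \<open>dominating\<close> into an inequality
    between the two generators, which can be iterated.\<close>
  define L where "L = l @ [(Q, 0)]"
  define R where "R = [(Q, X)] @ [(?W, 0)]"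
  have nn: "nonneg_list L" "nonneg_list R" using jb W by (auto simp: L_def R_def)
  have step: "shift_op L \<psi> t \<le> shift_op R \<psi> t" if "dominating p \<psi>" "0 \<le> t" for \<psi> t
    using dominatingD[OF that(1) assms(2) that(2)] by (simp add: shift_op_append L_def R_def)
  have "(shift_op L ^^ k) \<phi> t \<le> (shift_op R ^^ k) \<phi> t" if "0 \<le> t" for k t
    using that
  proof (induction k arbitrary: t)
    case (Suc k)
    \<comment> \<open>First positivity of the operator of \<open>L\<close> carries the induction
      hypothesis; then the generators are compared on \<open>(shift_op R ^^ k) \<phi>\<close>, which
      is still dominating.\<close>
    have "shift_op L ((shift_op L ^^ k) \<phi>) t \<le> shift_op L ((shift_op R ^^ k) \<phi>) t"
      using Suc nn by (intro shift_op_mono) (auto simp: nonneg_list_def)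
    also have "\<dots> \<le> shift_op R ((shift_op R ^^ k) \<phi>) t"
      using Suc nn by (intro step dominating_funpow_shift_op assms) auto
    finally show ?case by simp
  qed simp
  hence "exp_op L \<phi> s \<le> exp_op R \<phi> s"
    unfolding exp_op_def using assms by (intro suminf_le mult_left_mono) auto
  moreover have "exp_op L \<phi> s = ennreal (exp Q) * exp_op l \<phi> s"
    "exp_op R \<phi> s = ennreal (exp ?W) * exp_op [(Q, X)] \<phi> s"
  proof -
    have *: "exp_op (m @ [(w, 0)]) \<phi> s = ennreal (exp w) * exp_op m \<phi> s" if "0 \<le> w" for m w
    proof -
      have "exp_op (m @ [(w, 0)]) \<phi> s = exp_op m (\<lambda>t. ennreal (exp w) * \<phi> t) s"
        unfolding exp_op_append using exp_op_zero_shift[OF that] by presburger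
      thus ?thesis
        by (simp add: exp_op_def funpow_shift_op_cmult mult.left_commute)
    qed
    show "exp_op L \<phi> s = ennreal (exp Q) * exp_op l \<phi> s"
      "exp_op R \<phi> s = ennreal (exp ?W) * exp_op [(Q, X)] \<phi> s"
      unfolding L_def R_def using *[OF jb(2)] *[OF W] by blast+
  qed
  ultimately have "ennreal (exp (- ?W - Q)) * (ennreal (exp Q) * exp_op l \<phi> s)
     \<le> ennreal (exp (- ?W - Q)) * (ennreal (exp ?W) * exp_op [(Q, X)] \<phi> s)"
    by (intro mult_left_mono) auto
  thus ?thesis
    by (simp add: mult.assoc[symmetric] ennreal_mult[symmetric] exp_add[symmetric])
qed

text \<open>A Bernoulli step is dominated by a Poisson step with the same mean because \<open>dominating\<close>
  makes \<open>\<phi>\<close> convex along the multiples of \<open>x\<close>.\<close>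

lemma bernoulli_le_exp_op:
  assumes "dominating p \<phi>" "1 \<le> p" "0 \<le> q" "q \<le> 1" "0 < x" "0 \<le> s"
  shows "ennreal (1 - q) * \<phi> s + ennreal q * \<phi> (s + x) \<le> ennreal (exp (- q)) * exp_op [(q, x)] \<phi> s"
proof -
  \<comment> \<open>Poisson weights of mean \<open>q\<close>; \<open>cs\<close> and
    \<open>ck\<close> give their total mass and mean.\<close>
  define c where "c k = exp (- q) * (q ^ k / fact k)" for k :: nat
  have c0: "0 \<le> c k" for k using assms by (simp add: c_def)
  have rhs: "ennreal (exp (- q)) * exp_op [(q, x)] \<phi> s = (\<Sum>k. ennreal (c k) * \<phi> (s + real k * x))"
  proof -
    have "ennreal (c k) = ennreal (exp (- q)) * ennreal (q ^ k / fact k)" for k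
      unfolding c_def using assms by (intro ennreal_mult) auto
    thus ?thesis
      by (simp only: exp_op_single[OF \<open>0 \<le> q\<close>] ennreal_suminf_cmult[symmetric] mult.assoc)
  qed
  have cs: "c sums 1"
  proof -
    have "(\<lambda>k. exp (- q) * (q ^ k / fact k)) sums (exp (- q) * exp q)"
      using exp_converges[of q] by (intro sums_mult) (simp add: field_simps)
    thus ?thesis by (simp add: c_def[abs_def] exp_add[symmetric])
  qed
  have ck: "(\<lambda>k. c k * real k) sums q"
  proof -
    have "(\<lambda>k. c (Suc k) * real (Suc k)) = (\<lambda>k. q * c k)"
      by (simp add: c_def fact_Suc fun_eq_iff del: of_nat_Suc)
    moreover have "(\<lambda>k. q * c k) sums (q * 1)" by (intro sums_mult cs)
    ultimately show ?thesis using sums_Suc[of "\<lambda>k. c k * real k" q] by simp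
  qed
  \<comment> \<open>The empty jump list compared with a single jump \<open>y\<close>.\<close>
  have mono: "\<phi> s \<le> \<phi> (s + y)" if "0 \<le> y" for y
  proof (cases "y = 0")
    case False
    hence "jump_bounded p [] 1 y" using that by (auto simp: jump_bounded_def)
    from dominatingD[OF assms(1) this \<open>0 \<le> s\<close>] show ?thesis by simp
  qed simp
  \<comment> \<open>\<open>k\<close> jumps of size \<open>x\<close> compared with one jump
    \<open>k * x\<close>: the first moments agree, and the \<open>p\<close>-th moment of the latter
    is larger as \<open>1 \<le> p\<close>. Averaging over the Poisson weights gives
    \<open>key\<close>.\<close>
  have conv: "of_nat k * \<phi> (s + x) + \<phi> s \<le> \<phi> (s + real k * x) + of_nat k * \<phi> s" for k
  proof (cases "k = 0")
    case False
    have "real k * x powr p \<le> (real k * x) powr p"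
    proof -
      have "real k powr 1 \<le> real k powr p" using False assms by (intro powr_mono) auto
      thus ?thesis using assms False by (auto simp: powr_mult intro!: mult_right_mono)
    qed
    hence "jump_bounded p [(real k, x)] 1 (real k * x)"
      using False assms by (auto simp: jump_bounded_def)
    from dominatingD[OF assms(1) this \<open>0 \<le> s\<close>] show ?thesis
      by (simp add: ennreal_of_nat_eq_real_of_nat)
  qed simp
  have sum1: "(\<Sum>k. ennreal (c k)) = 1" and sumq: "(\<Sum>k. ennreal (c k) * of_nat k) = ennreal q"
  proof -
    have "(\<Sum>k. ennreal (c k)) = ennreal (\<Sum>k. c k)"
      using c0 sums_summable[OF cs] by (intro suminf_ennreal2) auto
    thus "(\<Sum>k. ennreal (c k)) = 1" using sums_unique[OF cs] by simp
    have "(\<Sum>k. ennreal (c k * real k)) = ennreal (\<Sum>k. c k * real k)"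
      using c0 sums_summable[OF ck] by (intro suminf_ennreal2) auto
    hence "(\<Sum>k. ennreal (c k * real k)) = ennreal q" using sums_unique[OF ck] by simp
    thus "(\<Sum>k. ennreal (c k) * of_nat k) = ennreal q"
      using c0 by (simp add: ennreal_mult ennreal_of_nat_eq_real_of_nat)
  qed
  have key: "ennreal q * \<phi> (s + x) + \<phi> s \<le> (\<Sum>k. ennreal (c k) * \<phi> (s + real k * x)) + ennreal q * \<phi> s"
  proof -
    have "(\<Sum>k. ennreal (c k) * (of_nat k * \<phi> (s + x) + \<phi> s))
        \<le> (\<Sum>k. ennreal (c k) * (\<phi> (s + real k * x) + of_nat k * \<phi> s))"
      by (intro suminf_le mult_left_mono conv) auto
    moreover have "(\<Sum>k. ennreal (c k) * (of_nat k * \<phi> (s + x) + \<phi> s))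
       = (\<Sum>k. ennreal (c k) * of_nat k * \<phi> (s + x)) + (\<Sum>k. ennreal (c k) * \<phi> s)"
      by (simp add: suminf_add[symmetric] distrib_left mult.assoc)
    moreover have "(\<Sum>k. ennreal (c k) * (\<phi> (s + real k * x) + of_nat k * \<phi> s))
       = (\<Sum>k. ennreal (c k) * \<phi> (s + real k * x)) + (\<Sum>k. ennreal (c k) * of_nat k * \<phi> s)"
      by (simp add: suminf_add[symmetric] distrib_left mult.assoc)
    ultimately show ?thesis by (simp only: ennreal_suminf_multc sum1 sumq mult_1)
  qed
  show ?thesis
  \<comment> \<open>Cancelling \<open>ennreal q * \<phi> s\<close> requires finiteness. If
    \<open>\<phi> s\<close> is infinite, monotonicity makes the right-hand side infinite
    too.\<close>
  proof (cases "\<phi> s = \<infinity>")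
    case True
    hence "\<phi> (s + real k * x) = \<infinity>" for k
      using mono[of "real k * x"] assms by (simp add: top_unique)
    hence "(\<Sum>k. ennreal (c k) * \<phi> (s + real k * x)) = \<infinity>"
      by (simp only: ennreal_suminf_multc sum1 mult_1)
    thus ?thesis unfolding rhs by simp
  next
    case False
    have "ennreal q * \<phi> s \<noteq> \<infinity>" using False by (simp add: ennreal_mult_eq_top_iff)
    moreover have "\<phi> s = ennreal (1 - q) * \<phi> s + ennreal q * \<phi> s"
      using assms by (simp add: distrib_right[symmetric] ennreal_plus[symmetric] del: ennreal_plus)
    hence "ennreal q * \<phi> s + (ennreal (1 - q) * \<phi> s + ennreal q * \<phi> (s + x))
       = ennreal q * \<phi> (s + x) + \<phi> s"
      by (metis add.assoc add.commute)
    hence "ennreal q * \<phi> s + (ennreal (1 - q) * \<phi> s + ennreal q * \<phi> (s + x))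
       \<le> ennreal q * \<phi> s + (\<Sum>k. ennreal (c k) * \<phi> (s + real k * x))"
      using key by (simp only: add.commute)
    ultimately show ?thesis
      unfolding rhs by (simp only: ennreal_add_left_cancel_le simp_thms)
  qed
qed

section \<open>Rosenthal's inequality with the Bell constant\<close>

context prob_space
begin

lemma integrable_of_integrable_powr:
  fixes \<zeta> :: "'a \<Rightarrow> real"
  assumes "1 \<le> p" "\<zeta> \<in> borel_measurable M" "\<And>\<omega>. \<omega> \<in> space M \<Longrightarrow> 0 \<le> \<zeta> \<omega>"
    "integrable M (\<lambda>\<omega>. \<zeta> \<omega> powr p)"
  shows "integrable M \<zeta>"
proof (rule Bochner_Integration.integrable_bound)
  show "integrable M (\<lambda>\<omega>. 1 + \<zeta> \<omega> powr p)" using assms by auto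
  have "\<zeta> \<omega> \<le> 1 + \<zeta> \<omega> powr p" if "\<omega> \<in> space M" for \<omega>
  proof (cases "\<zeta> \<omega> \<le> 1")
    case True thus ?thesis by (simp add: add_increasing2)
  next
    case False
    hence "\<zeta> \<omega> powr 1 \<le> \<zeta> \<omega> powr p" using assms by (intro powr_mono) auto
    thus ?thesis using False by simp
  qed
  thus "AE \<omega> in M. norm (\<zeta> \<omega>) \<le> norm (1 + \<zeta> \<omega> powr p)"
    using assms(3) by (intro AE_I2) (fastforce simp: abs_of_nonneg)
qed (use assms in auto)

text \<open>Jensen's inequality for the \<open>p\<close>-th power, by integrating Young's inequality
  for the product of \<open>\<zeta>\<close> and \<open>a powr (p - 1)\<close>, where
  \<open>a\<close> is the mean.\<close>

lemma expectation_powr_ge: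
  fixes \<zeta> :: "'a \<Rightarrow> real"
  assumes "1 < p" "\<zeta> \<in> borel_measurable M" "\<And>\<omega>. \<omega> \<in> space M \<Longrightarrow> 0 \<le> \<zeta> \<omega>"
    "integrable M (\<lambda>\<omega>. \<zeta> \<omega> powr p)"
  shows "expectation \<zeta> powr p \<le> expectation (\<lambda>\<omega>. \<zeta> \<omega> powr p)"
proof (cases "expectation \<zeta> = 0")
  case False
  define a where "a = expectation \<zeta>"
  have int: "integrable M \<zeta>" using integrable_of_integrable_powr[of p \<zeta>] assms by auto
  have "0 \<le> a" unfolding a_def using assms by (intro Bochner_Integration.integral_nonneg_AE) auto
  hence a: "0 < a" using False by (simp add: a_def)
  have "\<zeta> \<omega> * a powr (p - 1) \<le> \<zeta> \<omega> powr p / p + a powr p * (1 - 1 / p)" if "\<omega> \<in> space M" for \<omega>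
  proof -
    have "1 < p / (p - 1)" "1 / p + 1 / (p / (p - 1)) = 1" using assms by (auto simp: field_simps)
    hence "\<zeta> \<omega> * a powr (p - 1) \<le> \<zeta> \<omega> powr p / p + (a powr (p - 1)) powr (p / (p - 1)) / (p / (p - 1))"
      using assms(1,3) that by (intro Youngs_inequality) auto
    moreover have "(a powr (p - 1)) powr (p / (p - 1)) = a powr p" using assms by (simp add: powr_powr)
    moreover have "a powr p / (p / (p - 1)) = a powr p * (1 - 1 / p)" using assms by (simp add: field_simps)
    ultimately show ?thesis by simp
  qed
  hence "expectation (\<lambda>\<omega>. \<zeta> \<omega> * a powr (p - 1)) \<le> expectation (\<lambda>\<omega>. \<zeta> \<omega> powr p / p + a powr p * (1 - 1 / p))"
    using int assms by (intro integral_mono) auto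
  hence "a * a powr (p - 1) \<le> expectation (\<lambda>\<omega>. \<zeta> \<omega> powr p) / p + a powr p * (1 - 1 / p)"
    using int assms by (simp add: a_def prob_space)
  moreover have "a * a powr (p - 1) = a powr p" using a powr_add[of a 1 "p - 1"] by simp
  ultimately show ?thesis using assms by (simp add: a_def field_simps)
qed auto

text \<open>The tangent bound at \<open>x\<close> involves only the first and \<open>p\<close>-th
  moments and is exact at 0 and \<open>x\<close>. Hence the law on these two points with the same
  moments, giving \<open>x\<close> probability \<open>q\<close>, is a majorant.\<close>

lemma two_point_majorant:
  fixes \<zeta> :: "'a \<Rightarrow> real"
  assumes "2 \<le> p" "\<zeta> \<in> borel_measurable M" "\<And>\<omega>. \<omega> \<in> space M \<Longrightarrow> 0 \<le> \<zeta> \<omega>"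
    "integrable M (\<lambda>\<omega>. \<zeta> \<omega> powr p)"
  obtains q x where "0 \<le> q" "q \<le> 1" "0 < x" "q * x = expectation \<zeta>"
    "q * x powr p = expectation (\<lambda>\<omega>. \<zeta> \<omega> powr p)"
    "\<And>s. 0 \<le> s \<Longrightarrow> (\<integral>\<^sup>+\<omega>. ennreal ((s + \<zeta> \<omega>) powr p) \<partial>M) \<le> ennreal ((1 - q) * s powr p + q * (s + x) powr p)"
proof -
  define a where "a = expectation \<zeta>"
  define c where "c = expectation (\<lambda>\<omega>. \<zeta> \<omega> powr p)"
  have int: "integrable M \<zeta>" using integrable_of_integrable_powr[of p \<zeta>] assms by auto
  have "0 \<le> a" unfolding a_def using assms by (intro Bochner_Integration.integral_nonneg_AE) auto
  show ?thesis
  proof (cases "a = 0")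
    case True
    hence z: "AE \<omega> in M. \<zeta> \<omega> = 0"
      using integral_nonneg_eq_0_iff_AE[OF int] assms by (simp add: a_def)
    have "c = (\<integral>\<omega>. 0 \<partial>M)" unfolding c_def
      using z assms by (intro integral_cong_AE) auto
    moreover have "(\<integral>\<^sup>+\<omega>. ennreal ((s + \<zeta> \<omega>) powr p) \<partial>M) = ennreal (s powr p)" for s
    proof -
      have "(\<integral>\<^sup>+\<omega>. ennreal ((s + \<zeta> \<omega>) powr p) \<partial>M) = (\<integral>\<^sup>+\<omega>. ennreal (s powr p) \<partial>M)"
        using z by (intro nn_integral_cong_AE) auto
      thus ?thesis by (simp add: emeasure_space_1)
    qed
    ultimately show ?thesis using True by (intro that[of 0 1]) (auto simp: a_def c_def)
  next
    case False
    hence a: "0 < a" using \<open>0 \<le> a\<close> by simp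
    have ac: "a powr p \<le> c" unfolding a_def c_def using assms by (intro expectation_powr_ge) auto
    hence c: "0 < c" using a by (smt (verit) powr_gt_zero)
    \<comment> \<open>Solves \<open>q * x = a\<close> and \<open>q * x powr p = c\<close>. That
      \<open>q = a / x\<close> is at most 1 comes from Jensen's bound \<open>ac\<close>.\<close>
    define x where "x = (c / a) powr (1 / (p - 1))"
    have x: "0 < x" using a c by (simp add: x_def)
    have xp: "x powr (p - 1) = c / a" using assms a c by (simp add: x_def powr_powr)
    have xxp: "x powr p = x * (c / a)" using powr_add[of x 1 "p - 1"] x xp by simp
    have "a \<le> x"
    proof -
      have "a * a powr (p - 1) = a powr p" using a powr_add[of a 1 "p - 1"] by simp
      hence "a powr (p - 1) \<le> x powr (p - 1)" using ac a by (simp add: xp field_simps)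
      thus ?thesis using assms a x powr_less_mono2[of "p - 1" x a] by force
    qed
    define q where "q = a / x"
    have q: "0 \<le> q" "q \<le> 1" "q * x = a" "q * x powr p = c"
      using a x \<open>a \<le> x\<close> by (auto simp: q_def xxp)
    show ?thesis
    proof (rule that[of q x])
      fix s :: real assume s: "0 \<le> s"
      obtain \<alpha> \<beta> where ab: "0 \<le> \<alpha>" "0 \<le> \<beta>"
        "\<And>y. 0 \<le> y \<Longrightarrow> (s + y) powr p - s powr p \<le> \<alpha> * y + \<beta> * y powr p"
        "\<alpha> * x + \<beta> * x powr p = (s + x) powr p - s powr p"
        using powr_increment_tangent[OF assms(1) s x] by blast
      have "(\<integral>\<^sup>+\<omega>. ennreal ((s + \<zeta> \<omega>) powr p) \<partial>M)
          \<le> (\<integral>\<^sup>+\<omega>. ennreal (s powr p + \<alpha> * \<zeta> \<omega> + \<beta> * \<zeta> \<omega> powr p) \<partial>M)"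
      proof (intro nn_integral_mono ennreal_leI)
        fix \<omega> assume "\<omega> \<in> space M"
        thus "(s + \<zeta> \<omega>) powr p \<le> s powr p + \<alpha> * \<zeta> \<omega> + \<beta> * \<zeta> \<omega> powr p"
          using ab(3)[of "\<zeta> \<omega>"] assms(3) by auto
      qed
      also have "\<dots> = ennreal (\<integral>\<omega>. s powr p + \<alpha> * \<zeta> \<omega> + \<beta> * \<zeta> \<omega> powr p \<partial>M)"
        using int assms ab by (intro nn_integral_eq_integral) auto
      also have "(\<integral>\<omega>. s powr p + \<alpha> * \<zeta> \<omega> + \<beta> * \<zeta> \<omega> powr p \<partial>M) = s powr p + \<alpha> * a + \<beta> * c"
        using int assms by (simp add: a_def c_def prob_space)
      also have "\<dots> = s powr p + q * (\<alpha> * x + \<beta> * x powr p)"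
        by (simp add: q(3,4)[symmetric] algebra_simps)
      also have "\<dots> = (1 - q) * s powr p + q * (s + x) powr p"
        unfolding ab(4) by (simp add: algebra_simps)
      finally show "(\<integral>\<^sup>+\<omega>. ennreal ((s + \<zeta> \<omega>) powr p) \<partial>M)
        \<le> ennreal ((1 - q) * s powr p + q * (s + x) powr p)" .
    qed (use q x in \<open>auto simp: a_def c_def\<close>)
  qed
qed

lemma nn_integral_indep_pair:
  assumes "indep_var S X T Y" "h \<in> borel_measurable (S \<Otimes>\<^sub>M T)"
  shows "(\<integral>\<^sup>+\<omega>. h (X \<omega>, Y \<omega>) \<partial>M) = (\<integral>\<^sup>+\<omega>'. \<integral>\<^sup>+\<omega>. h (X \<omega>, Y \<omega>') \<partial>M \<partial>M)"
proof -
  have rv [measurable]: "X \<in> measurable M S" "Y \<in> measurable M T"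
    using assms(1) indep_var_rv1 indep_var_rv2 by blast+
  have D: "distr M S X \<Otimes>\<^sub>M distr M T Y = distr M (S \<Otimes>\<^sub>M T) (\<lambda>\<omega>. (X \<omega>, Y \<omega>))"
    using assms(1) indep_var_distribution_eq by blast
  interpret X: prob_space "distr M S X" by (rule prob_space_distr) simp
  interpret Y: prob_space "distr M T Y" by (rule prob_space_distr) simp
  interpret XY: pair_sigma_finite "distr M S X" "distr M T Y" ..
  note assms(2) [measurable]
  have "(\<integral>\<^sup>+\<omega>. h (X \<omega>, Y \<omega>) \<partial>M) = (\<integral>\<^sup>+z. h z \<partial>(distr M S X \<Otimes>\<^sub>M distr M T Y))"
    unfolding D by (subst nn_integral_distr) auto
  also have "\<dots> = (\<integral>\<^sup>+y. \<integral>\<^sup>+x. h (x, y) \<partial>distr M S X \<partial>distr M T Y)"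
    by (rule XY.nn_integral_snd[symmetric]) simp
  also have "\<dots> = (\<integral>\<^sup>+\<omega>'. \<integral>\<^sup>+x. h (x, Y \<omega>') \<partial>distr M S X \<partial>M)"
    by (subst nn_integral_distr) auto
  also have "\<dots> = (\<integral>\<^sup>+\<omega>'. \<integral>\<^sup>+\<omega>. h (X \<omega>, Y \<omega>') \<partial>M \<partial>M)"
  proof (intro nn_integral_cong)
    fix \<omega>' assume "\<omega>' \<in> space M"
    hence "Y \<omega>' \<in> space T" using rv(2) by (rule measurable_space[rotated])
    hence [measurable]: "(\<lambda>x. h (x, Y \<omega>')) \<in> borel_measurable S" by measurable
    show "(\<integral>\<^sup>+x. h (x, Y \<omega>') \<partial>distr M S X) = (\<integral>\<^sup>+\<omega>. h (X \<omega>, Y \<omega>') \<partial>M)"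
      by (subst nn_integral_distr) auto
  qed
  finally show ?thesis .
qed

text \<open>Variables are replaced one at a time: with the remaining sum frozen, the new one becomes
  a two-point variable; the induction hypothesis bounds the rest from \<open>s\<close> and from
  \<open>s + x\<close>; finally the Bernoulli step becomes a Poisson step. This is why the starting
  point \<open>s\<close> is arbitrary.\<close>

lemma indep_sum_le_exp_op:
  fixes \<zeta> :: "'i \<Rightarrow> 'a \<Rightarrow> real"
  assumes "2 \<le> p" "finite I" "indep_vars (\<lambda>_. borel) \<zeta> I"
    "\<And>i \<omega>. i \<in> I \<Longrightarrow> \<omega> \<in> space M \<Longrightarrow> 0 \<le> \<zeta> i \<omega>"
    "\<And>i. i \<in> I \<Longrightarrow> integrable M (\<lambda>\<omega>. \<zeta> i \<omega> powr p)"
  shows "\<exists>l. nonneg_list l \<and> (\<Sum>(w, x)\<leftarrow>l. w * x) = (\<Sum>i\<in>I. expectation (\<zeta> i)) \<and>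
     (\<Sum>(w, x)\<leftarrow>l. w * x powr p) = (\<Sum>i\<in>I. expectation (\<lambda>\<omega>. \<zeta> i \<omega> powr p)) \<and>
     (\<forall>s\<ge>0. (\<integral>\<^sup>+\<omega>. ennreal ((s + (\<Sum>i\<in>I. \<zeta> i \<omega>)) powr p) \<partial>M)
        \<le> ennreal (exp (- total_weight l)) * exp_op l (\<lambda>t. ennreal (t powr p)) s)"
  using assms(2-)
proof (induction I rule: finite_induct)
  case empty
  show ?case
    \<comment> \<open>An atom of weight 0 represents the zero jump measure in a form that
      \<open>exp_op_zero_shift\<close> evaluates.\<close>
    by (intro exI[of _ "[(0, 0)]"]) (auto simp: exp_op_zero_shift emeasure_space_1)
next
  case (insert i J)
  let ?\<phi> = "\<lambda>t. ennreal (t powr p)"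
  let ?R = "\<lambda>\<omega>. \<Sum>j\<in>J. \<zeta> j \<omega>"
  have rv: "\<zeta> j \<in> borel_measurable M" if "j \<in> insert i J" for j
    using insert.prems(1) that by (auto simp: indep_vars_def)
  have rvi [measurable]: "\<zeta> i \<in> borel_measurable M" by (rule rv) simp
  have rvR [measurable]: "?R \<in> borel_measurable M" using rv by (intro borel_measurable_sum) auto
  have "indep_vars (\<lambda>_. borel) \<zeta> J" using insert.prems(1) by (rule indep_vars_subset) auto
  then obtain l where l: "nonneg_list l" "(\<Sum>(w, x)\<leftarrow>l. w * x) = (\<Sum>i\<in>J. expectation (\<zeta> i))"
     "(\<Sum>(w, x)\<leftarrow>l. w * x powr p) = (\<Sum>i\<in>J. expectation (\<lambda>\<omega>. \<zeta> i \<omega> powr p))"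
     "\<And>s. 0 \<le> s \<Longrightarrow> (\<integral>\<^sup>+\<omega>. ennreal ((s + ?R \<omega>) powr p) \<partial>M)
        \<le> ennreal (exp (- total_weight l)) * exp_op l ?\<phi> s"
    using insert.IH insert.prems by (auto simp del: sum_list.Cons)
  obtain q x where qx: "0 \<le> q" "q \<le> 1" "0 < x" "q * x = expectation (\<zeta> i)"
    "q * x powr p = expectation (\<lambda>\<omega>. \<zeta> i \<omega> powr p)"
    and two: "\<And>s. 0 \<le> s \<Longrightarrow> (\<integral>\<^sup>+\<omega>. ennreal ((s + \<zeta> i \<omega>) powr p) \<partial>M)
        \<le> ennreal ((1 - q) * s powr p + q * (s + x) powr p)"
    using two_point_majorant[OF assms(1) rvi] insert.prems by (metis insertI1)
  have Rnn: "0 \<le> ?R \<omega>" if "\<omega> \<in> space M" for \<omega>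
    using that insert.prems by (intro sum_nonneg) auto
  have "(\<integral>\<^sup>+\<omega>. ennreal ((s + (\<Sum>j\<in>insert i J. \<zeta> j \<omega>)) powr p) \<partial>M)
      \<le> ennreal (exp (- total_weight ((q, x) # l))) * exp_op ((q, x) # l) ?\<phi> s"
    if s: "0 \<le> s" for s
  proof -
    have dom: "dominating p (exp_op l ?\<phi>)"
      by (intro dominating_exp_op dominating_powr assms(1) l(1))
    have "(\<integral>\<^sup>+\<omega>. ennreal ((s + (\<Sum>j\<in>insert i J. \<zeta> j \<omega>)) powr p) \<partial>M)
       = (\<integral>\<^sup>+\<omega>. (\<lambda>(z, r). ennreal ((s + r + z) powr p)) (\<zeta> i \<omega>, ?R \<omega>) \<partial>M)"
      using insert.hyps by (simp add: add_ac)
    also have "\<dots> = (\<integral>\<^sup>+\<omega>'. \<integral>\<^sup>+\<omega>. (\<lambda>(z, r). ennreal ((s + r + z) powr p)) (\<zeta> i \<omega>, ?R \<omega>') \<partial>M \<partial>M)"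
      using indep_vars_sum[OF insert.hyps(1,2) insert.prems(1)] by (intro nn_integral_indep_pair) measurable
    also have "\<dots> \<le> (\<integral>\<^sup>+\<omega>'. ennreal ((1 - q) * (s + ?R \<omega>') powr p + q * (s + x + ?R \<omega>') powr p) \<partial>M)"
    proof (intro nn_integral_mono)
      fix \<omega>' assume "\<omega>' \<in> space M"
      thus "(\<integral>\<^sup>+\<omega>. (\<lambda>(z, r). ennreal ((s + r + z) powr p)) (\<zeta> i \<omega>, ?R \<omega>') \<partial>M)
         \<le> ennreal ((1 - q) * (s + ?R \<omega>') powr p + q * (s + x + ?R \<omega>') powr p)"
        using two[of "s + ?R \<omega>'"] Rnn[of \<omega>'] s by (simp add: add_ac)
    qed
    also have "\<dots> = (\<integral>\<^sup>+\<omega>'. ennreal (1 - q) * ennreal ((s + ?R \<omega>') powr p)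
         + ennreal q * ennreal ((s + x + ?R \<omega>') powr p) \<partial>M)"
      using qx by (intro nn_integral_cong) (simp add: ennreal_mult)
    also have "\<dots> = ennreal (1 - q) * (\<integral>\<^sup>+\<omega>'. ennreal ((s + ?R \<omega>') powr p) \<partial>M)
         + ennreal q * (\<integral>\<^sup>+\<omega>'. ennreal ((s + x + ?R \<omega>') powr p) \<partial>M)"
      by (simp add: nn_integral_add nn_integral_cmult)
    also have "\<dots> \<le> ennreal (1 - q) * (ennreal (exp (- total_weight l)) * exp_op l ?\<phi> s)
         + ennreal q * (ennreal (exp (- total_weight l)) * exp_op l ?\<phi> (s + x))"
      using s qx by (intro add_mono mult_left_mono l(4)) auto
    also have "\<dots> = ennreal (exp (- total_weight l)) *
        (ennreal (1 - q) * exp_op l ?\<phi> s + ennreal q * exp_op l ?\<phi> (s + x))"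
      by (simp add: algebra_simps)
    also have "\<dots> \<le> ennreal (exp (- total_weight l)) *
        (ennreal (exp (- q)) * exp_op [(q, x)] (exp_op l ?\<phi>) s)"
      using dom qx s assms(1) by (intro mult_left_mono bernoulli_le_exp_op) auto
    also have "\<dots> = ennreal (exp (- total_weight l)) * ennreal (exp (- q)) * exp_op ([(q, x)] @ l) ?\<phi> s"
      unfolding exp_op_append by (simp only: mult.assoc)
    also have "ennreal (exp (- total_weight l)) * ennreal (exp (- q)) = ennreal (exp (- total_weight ((q, x) # l)))"
      by (simp add: ennreal_mult[symmetric] exp_add[symmetric])
    finally show ?thesis by simp
  qed
  thus ?case
    using l qx insert.hyps by (intro exI[of _ "(q, x) # l"]) auto
qed

end

text \<open>From \<open>t \<le> exp t\<close> at \<open>t = k / p\<close>, the numerator is at most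
  \<open>p powr p * exp k\<close>, which leaves an exponential series.\<close>

lemma summable_bell:
  assumes "0 < p"
  shows "summable (\<lambda>k. real k powr p / fact k)"
proof (rule summable_comparison_test')
  show "summable (\<lambda>k. p powr p * (exp 1 ^ k / fact k) :: real)"
    using summable_exp[of "exp 1 :: real"] by (intro summable_mult) (simp add: field_simps)
  fix k :: nat assume "0 \<le> k"
  have "real k powr p \<le> p powr p * exp (real k)"
  proof -
    have "real k / p \<le> exp (real k / p)" using exp_ge_add_one_self[of "real k / p"] by linarith
    hence "(real k / p) powr p \<le> exp (real k / p) powr p"
      using assms by (intro powr_mono2) auto
    also have "\<dots> = exp (real k)" using assms by (simp add: exp_powr_real)
    finally show ?thesis using assms by (simp add: powr_divide field_simps)
  qed
  thus "norm (real k powr p / fact k) \<le> p powr p * (exp 1 ^ k / fact k)"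
    by (simp add: divide_right_mono exp_of_nat_mult[symmetric])
qed

lemma bell_fun_pos:
  assumes "0 < p"
  shows "0 < bell_fun p"
  unfolding bell_fun_def
  by (intro mult_pos_pos suminf_pos2[of _ 1] summable_bell assms) auto

lemma (in prob_space) rosenthal_bell:
  fixes \<zeta> :: "'i \<Rightarrow> 'a \<Rightarrow> real"
  assumes "2 \<le> p" "finite I" "indep_vars (\<lambda>_. borel) \<zeta> I"
    "\<And>i \<omega>. i \<in> I \<Longrightarrow> \<omega> \<in> space M \<Longrightarrow> 0 \<le> \<zeta> i \<omega>"
    "\<And>i. i \<in> I \<Longrightarrow> integrable M (\<lambda>\<omega>. \<zeta> i \<omega> powr p)"
    and m: "0 < m" "(\<Sum>i\<in>I. expectation (\<zeta> i)) \<le> m"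
      "(\<Sum>i\<in>I. expectation (\<lambda>\<omega>. \<zeta> i \<omega> powr p)) \<le> m powr p"
  shows "expectation (\<lambda>\<omega>. (\<Sum>i\<in>I. \<zeta> i \<omega>) powr p) \<le> bell_fun p * m powr p"
proof -
  let ?\<phi> = "\<lambda>t. ennreal (t powr p)"
  obtain l where l: "nonneg_list l" "(\<Sum>(w, x)\<leftarrow>l. w * x) = (\<Sum>i\<in>I. expectation (\<zeta> i))"
     "(\<Sum>(w, x)\<leftarrow>l. w * x powr p) = (\<Sum>i\<in>I. expectation (\<lambda>\<omega>. \<zeta> i \<omega> powr p))"
     "\<And>s. 0 \<le> s \<Longrightarrow> (\<integral>\<^sup>+\<omega>. ennreal ((s + (\<Sum>i\<in>I. \<zeta> i \<omega>)) powr p) \<partial>M)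
        \<le> ennreal (exp (- total_weight l)) * exp_op l ?\<phi> s"
    using indep_sum_le_exp_op[OF assms(1-5)] by auto
  have "(\<integral>\<^sup>+\<omega>. ennreal ((\<Sum>i\<in>I. \<zeta> i \<omega>) powr p) \<partial>M)
      \<le> ennreal (exp (- total_weight l)) * exp_op l ?\<phi> 0"
    using l(4)[of 0] by simp
  also have "\<dots> \<le> ennreal (exp (- 1)) * exp_op [(1, m)] ?\<phi> 0"
  proof (rule exp_op_compare)
    \<comment> \<open>Mass 1 at \<open>m\<close> corresponds to \<open>m\<close> times a Poisson
      variable of mean 1, whose \<open>p\<close>-th moment is
      \<open>bell_fun p * m powr p\<close>.\<close>
    show "jump_bounded p l 1 m" using l m by (simp add: jump_bounded_def)
  qed (use assms(1) in \<open>auto intro: dominating_powr\<close>)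
  also have "exp_op [(1, m)] ?\<phi> 0 = ennreal ((\<Sum>k. real k powr p / fact k) * m powr p)"
  proof -
    have "exp_op [(1, m)] ?\<phi> 0 = (\<Sum>k. ennreal (1 ^ k / fact k) * ennreal ((0 + real k * m) powr p))"
      by (rule exp_op_single) simp
    also have "\<dots> = (\<Sum>k. ennreal (real k powr p / fact k * m powr p))"
      using m by (simp add: powr_mult ennreal_mult[symmetric])
    also have "\<dots> = ennreal (\<Sum>k. real k powr p / fact k * m powr p)"
      using summable_bell[of p] assms(1) by (intro suminf_ennreal2 summable_mult2) auto
    also have "(\<Sum>k. real k powr p / fact k * m powr p) = (\<Sum>k. real k powr p / fact k) * m powr p"
      using summable_bell[of p] assms(1) by (intro suminf_mult2[symmetric]) auto
    finally show ?thesis .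
  qed
  also have "ennreal (exp (- 1)) * ennreal ((\<Sum>k. real k powr p / fact k) * m powr p)
      = ennreal (bell_fun p * m powr p)"
    by (simp add: bell_fun_def ennreal_mult'[symmetric] mult_ac)
  finally have le: "(\<integral>\<^sup>+\<omega>. ennreal ((\<Sum>i\<in>I. \<zeta> i \<omega>) powr p) \<partial>M) \<le> ennreal (bell_fun p * m powr p)" .
  have nn: "0 \<le> bell_fun p * m powr p" using bell_fun_pos[of p] assms(1) by simp
  show ?thesis
  proof (cases "integrable M (\<lambda>\<omega>. (\<Sum>i\<in>I. \<zeta> i \<omega>) powr p)")
    case True
    thus ?thesis using le nn by (subst (asm) nn_integral_eq_integral) auto
  next
    case False
    \<comment> \<open>The integral of a non-integrable function is 0 by convention, so nonnegativity
      of the bound is enough.\<close>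
    thus ?thesis using nn by (simp add: not_integrable_integral_eq)
  qed
qed

section \<open>The spaces of p-integrable functions\<close>

lemma Lp_space_D:
  assumes "h \<in> Lp_space M p"
  shows "h \<in> borel_measurable M" "integrable M (\<lambda>x. \<bar>h x\<bar> powr p)"
  using assms by (auto simp: Lp_space_def)

lemma Lp_norm_nonneg: "0 \<le> Lp_norm M p h"
  by (simp add: Lp_norm_def)

lemma Lp_norm_powr:
  assumes "0 < p"
  shows "Lp_norm M p h powr p = (\<integral>x. \<bar>h x\<bar> powr p \<partial>M)"
  using assms by (simp add: Lp_norm_def powr_powr)

lemma Lp_norm_leI:
  assumes "0 < p" "0 \<le> a" "(\<integral>x. \<bar>h x\<bar> powr p \<partial>M) \<le> a powr p"
  shows "Lp_norm M p h \<le> a"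
proof -
  have "Lp_norm M p h \<le> (a powr p) powr (1 / p)"
    unfolding Lp_norm_def using assms by (intro powr_mono2) auto
  thus ?thesis using assms by (simp add: powr_powr)
qed

lemma Lp_norm_cong:
  assumes "\<And>x. x \<in> space M \<Longrightarrow> h x = h' x"
  shows "Lp_norm M p h = Lp_norm M p h'"
  unfolding Lp_norm_def using assms by (simp cong: Bochner_Integration.integral_cong)

lemma Lp_space_cong:
  assumes "\<And>x. x \<in> space M \<Longrightarrow> h x = h' x"
  shows "h \<in> Lp_space M p \<longleftrightarrow> h' \<in> Lp_space M p"
  unfolding Lp_space_def using assms by (simp cong: measurable_cong Bochner_Integration.integrable_cong)

lemma Lp_cmult:
  assumes "0 < p" "h \<in> Lp_space M p"
  shows "(\<lambda>x. c * h x) \<in> Lp_space M p" "Lp_norm M p (\<lambda>x. c * h x) = \<bar>c\<bar> * Lp_norm M p h"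
  using assms by (auto simp: Lp_space_def Lp_norm_def abs_mult powr_mult powr_powr)

text \<open>Minkowski's inequality: the pointwise weighted bound, with the two norms as weights,
  integrates to the \<open>p\<close>-th power of their sum.\<close>

lemma Lp_add:
  assumes p: "1 \<le> p" and f: "f \<in> Lp_space M p" and h: "h \<in> Lp_space M p"
  shows "(\<lambda>x. f x + h x) \<in> Lp_space M p"
    and "Lp_norm M p (\<lambda>x. f x + h x) \<le> Lp_norm M p f + Lp_norm M p h"
proof -
  note [measurable] = Lp_space_D(1)[OF f] Lp_space_D(1)[OF h]
  note int = Lp_space_D(2)[OF f] Lp_space_D(2)[OF h]
  have pw: "\<bar>f x + h x\<bar> powr p
      \<le> (a + b) powr (p - 1) * (a powr (1 - p) * \<bar>f x\<bar> powr p + b powr (1 - p) * \<bar>h x\<bar> powr p)"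
    if "0 < a" "0 < b" for a b x
  proof -
    have "\<bar>f x + h x\<bar> powr p \<le> (\<bar>f x\<bar> + \<bar>h x\<bar>) powr p"
      using p by (intro powr_mono2) auto
    also have "\<dots> \<le> (a + b) powr (p - 1) * (a powr (1 - p) * \<bar>f x\<bar> powr p + b powr (1 - p) * \<bar>h x\<bar> powr p)"
      using p that by (intro powr_add_le_weighted) auto
    finally show ?thesis .
  qed
  have i: "integrable M (\<lambda>x. \<bar>f x + h x\<bar> powr p)"
  proof (rule Bochner_Integration.integrable_bound)
    \<comment> \<open>Weights 1 and 1 already give an integrable majorant.\<close>
    show "integrable M (\<lambda>x. (1 + 1) powr (p - 1) * (1 powr (1 - p) * \<bar>f x\<bar> powr p + 1 powr (1 - p) * \<bar>h x\<bar> powr p))"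
      using int by (intro integrable_mult_right Bochner_Integration.integrable_add)
    show "AE x in M. norm (\<bar>f x + h x\<bar> powr p)
        \<le> norm ((1 + 1) powr (p - 1) * (1 powr (1 - p) * \<bar>f x\<bar> powr p + 1 powr (1 - p) * \<bar>h x\<bar> powr p))"
      using pw[of 1 1] by (intro AE_I2) (smt (verit) real_norm_def powr_ge_zero)
  qed measurable
  thus "(\<lambda>x. f x + h x) \<in> Lp_space M p" by (simp add: Lp_space_def)
  show "Lp_norm M p (\<lambda>x. f x + h x) \<le> Lp_norm M p f + Lp_norm M p h"
  proof (rule field_le_epsilon)
    fix e :: real assume e: "0 < e"
    \<comment> \<open>The extra \<open>e / 2\<close> keeps the weights positive when a norm
      vanishes.\<close>
    define a where "a = Lp_norm M p f + e / 2"
    define b where "b = Lp_norm M p h + e / 2"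
    have ab: "0 < a" "0 < b" "Lp_norm M p f \<le> a" "Lp_norm M p h \<le> b"
      using e Lp_norm_nonneg[of M p f] Lp_norm_nonneg[of M p h] by (auto simp: a_def b_def)
    have one: "z powr (1 - p) * Lp_norm M p u powr p \<le> z" if "0 < z" "Lp_norm M p u \<le> z" for z u
    proof -
      have "z powr (1 - p) * Lp_norm M p u powr p \<le> z powr (1 - p) * z powr p"
        using that p Lp_norm_nonneg[of M p u] by (intro mult_left_mono powr_mono2) auto
      also have "\<dots> = z" using that by (simp flip: powr_add)
      finally show ?thesis .
    qed
    have "(\<integral>x. \<bar>f x + h x\<bar> powr p \<partial>M)
        \<le> (\<integral>x. (a + b) powr (p - 1) * (a powr (1 - p) * \<bar>f x\<bar> powr p + b powr (1 - p) * \<bar>h x\<bar> powr p) \<partial>M)"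
      using i int pw[OF ab(1,2)] by (intro integral_mono) auto
    also have "\<dots> = (a + b) powr (p - 1) * (a powr (1 - p) * Lp_norm M p f powr p + b powr (1 - p) * Lp_norm M p h powr p)"
      using int p by (simp add: Lp_norm_powr)
    also have "\<dots> \<le> (a + b) powr (p - 1) * (a + b)"
      using ab by (intro mult_left_mono add_mono one) auto
    also have "\<dots> = (a + b) powr p"
      using ab powr_add[of "a + b" "p - 1" 1] by simp
    finally have "Lp_norm M p (\<lambda>x. f x + h x) \<le> a + b"
      using p ab by (intro Lp_norm_leI) auto
    thus "Lp_norm M p (\<lambda>x. f x + h x) \<le> Lp_norm M p f + Lp_norm M p h + e"
      by (simp add: a_def b_def)
  qed
qed

lemma Lp_zero: "(\<lambda>_. 0) \<in> Lp_space M p" "Lp_norm M p (\<lambda>_. 0) = 0"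
  by (auto simp: Lp_space_def Lp_norm_def)

lemma Lp_sum:
  assumes "1 \<le> p" "finite I" "\<And>i. i \<in> I \<Longrightarrow> h i \<in> Lp_space M p"
  shows "(\<lambda>x. \<Sum>i\<in>I. h i x) \<in> Lp_space M p"
    and "Lp_norm M p (\<lambda>x. \<Sum>i\<in>I. h i x) \<le> (\<Sum>i\<in>I. Lp_norm M p (h i))"
proof -
  have "(\<lambda>x. \<Sum>i\<in>I. h i x) \<in> Lp_space M p \<and> Lp_norm M p (\<lambda>x. \<Sum>i\<in>I. h i x) \<le> (\<Sum>i\<in>I. Lp_norm M p (h i))"
    using assms(2,3)
  proof (induction I rule: finite_induct)
    case (insert i I)
    thus ?case
      using Lp_add[OF assms(1), of "h i" M "\<lambda>x. \<Sum>i\<in>I. h i x"] by fastforce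
  qed (simp add: Lp_zero)
  thus "(\<lambda>x. \<Sum>i\<in>I. h i x) \<in> Lp_space M p"
    "Lp_norm M p (\<lambda>x. \<Sum>i\<in>I. h i x) \<le> (\<Sum>i\<in>I. Lp_norm M p (h i))" by auto
qed

lemma Lp_distr:
  assumes "X \<in> measurable M N" "h \<in> borel_measurable N"
  shows "Lp_norm (distr M N X) p h = Lp_norm M p (\<lambda>\<omega>. h (X \<omega>))"
    and "h \<in> Lp_space (distr M N X) p \<longleftrightarrow> (\<lambda>\<omega>. h (X \<omega>)) \<in> Lp_space M p"
  using assms by (auto simp: Lp_norm_def Lp_space_def integral_distr integrable_distr_eq)

lemma Lp_prod_indep:
  assumes "prob_space M" "finite I" "I \<noteq> {}" "0 < p" "prob_space.indep_vars M (\<lambda>_. borel) Y I"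
    "\<And>i. i \<in> I \<Longrightarrow> Y i \<in> Lp_space M p"
  shows "(\<lambda>\<omega>. \<Prod>i\<in>I. Y i \<omega>) \<in> Lp_space M p"
    and "Lp_norm M p (\<lambda>\<omega>. \<Prod>i\<in>I. Y i \<omega>) = (\<Prod>i\<in>I. Lp_norm M p (Y i))"
proof -
  interpret prob_space M by fact
  have e: "\<bar>\<Prod>i\<in>I. Y i \<omega>\<bar> powr p = (\<Prod>i\<in>I. \<bar>Y i \<omega>\<bar> powr p)" for \<omega>
    by (simp add: abs_prod prod_powr_distrib)
  have ind: "indep_vars (\<lambda>_. borel) (\<lambda>i \<omega>. \<bar>Y i \<omega>\<bar> powr p) I"
    by (rule indep_vars_compose2[OF assms(5)]) measurable
  have "integrable M (\<lambda>\<omega>. \<Prod>i\<in>I. \<bar>Y i \<omega>\<bar> powr p)"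
    using assms by (intro indep_vars_integrable ind) (auto simp: Lp_space_def)
  moreover have "(\<lambda>\<omega>. \<Prod>i\<in>I. Y i \<omega>) \<in> borel_measurable M"
    using assms(6) by (intro borel_measurable_prod) (auto simp: Lp_space_def)
  ultimately show "(\<lambda>\<omega>. \<Prod>i\<in>I. Y i \<omega>) \<in> Lp_space M p"
    by (simp add: Lp_space_def e)
  have "(\<integral>\<omega>. \<bar>\<Prod>i\<in>I. Y i \<omega>\<bar> powr p \<partial>M) = (\<Prod>i\<in>I. \<integral>\<omega>. \<bar>Y i \<omega>\<bar> powr p \<partial>M)"
    unfolding e using assms by (intro indep_vars_lebesgue_integral ind) (auto simp: Lp_space_def)
  thus "Lp_norm M p (\<lambda>\<omega>. \<Prod>i\<in>I. Y i \<omega>) = (\<Prod>i\<in>I. Lp_norm M p (Y i))"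
    unfolding Lp_norm_def by (simp add: prod_powr_distrib)
qed

lemma Lp_markov:
  assumes "prob_space M" "0 < p" "h \<in> Lp_space M p" "0 < y"
  shows "measure M {\<omega> \<in> space M. y \<le> h \<omega>} \<le> (Lp_norm M p h / y) powr p"
proof -
  interpret prob_space M by fact
  note [measurable] = Lp_space_D(1)[OF assms(3)]
  have "measure M {\<omega> \<in> space M. y \<le> h \<omega>} \<le> measure M {\<omega> \<in> space M. y powr p \<le> \<bar>h \<omega>\<bar> powr p}"
    using assms by (intro finite_measure_mono) (auto intro!: powr_mono2)
  also have "\<dots> \<le> (\<integral>\<omega>. \<bar>h \<omega>\<bar> powr p \<partial>M) / y powr p"
    using assms Lp_space_D(2)[OF assms(3)] by (intro integral_Markov_inequality_measure[where A = "{}"]) auto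
  also have "\<dots> = (Lp_norm M p h / y) powr p"
    using assms Lp_norm_nonneg[of M p h] by (simp add: powr_divide Lp_norm_powr)
  finally show ?thesis .
qed

text \<open>For \<open>\<psi> p > 0\<close>, \<open>(\<psi> p / y) powr p\<close> is the exponential
  of \<open>- (p * ln y - p * ln (\<psi> p))\<close>, so bounds for all \<open>p\<close> combine
  into the Legendre transform. If \<open>r > 0\<close>, then \<open>\<psi>\<close> cannot vanish on
  the range and the transform is finite; if \<open>r = 0\<close>, the claim is trivial.\<close>

lemma exp_ereal_neg_zeta_star_ge:
  assumes "p_range b \<noteq> {}" "0 < y" "0 \<le> r"
    "\<And>p. p \<in> p_range b \<Longrightarrow> 0 \<le> \<psi> p \<and> r \<le> (\<psi> p / y) powr p"
  shows "ereal r \<le> exp_ereal (- zeta_star b \<psi> (ln y))"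
proof (cases "r = 0")
  case True
  thus ?thesis by (simp add: exp_ereal_def)
next
  case False
  hence r: "0 < r" using assms by simp
  have le: "ereal (p * ln y) - zeta \<psi> p \<le> ereal (- ln r)" and pos: "0 < \<psi> p" if p: "p \<in> p_range b" for p
  proof -
    have "0 < (\<psi> p / y) powr p" using assms(4)[OF p] r by linarith
    thus "0 < \<psi> p" using assms(4)[OF p] by (cases "\<psi> p = 0") auto
    have "ln r \<le> ln ((\<psi> p / y) powr p)" using assms(4)[OF p] r by (intro ln_mono) auto
    also have "\<dots> = p * ln (\<psi> p) - p * ln y"
      using \<open>0 < \<psi> p\<close> assms(2) by (simp add: ln_powr ln_div right_diff_distrib)
    finally show "ereal (p * ln y) - zeta \<psi> p \<le> ereal (- ln r)"
      using \<open>0 < \<psi> p\<close> by (simp add: zeta_def)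
  qed
  have up: "zeta_star b \<psi> (ln y) \<le> ereal (- ln r)"
    unfolding zeta_star_def by (intro SUP_least le)
  obtain p where p: "p \<in> p_range b" using assms(1) by auto
  \<comment> \<open>A single \<open>p\<close> in the range excludes the value
    \<open>-\<infinity>\<close>; \<open>up\<close> excludes \<open>\<infinity>\<close>.\<close>
  have "ereal (p * ln y - p * ln (\<psi> p)) \<le> zeta_star b \<psi> (ln y)"
    unfolding zeta_star_def using pos[OF p] p by (intro SUP_upper2[of p]) (auto simp: zeta_def)
  then obtain z where z: "zeta_star b \<psi> (ln y) = ereal z"
    using up by (cases "zeta_star b \<psi> (ln y)") auto
  hence "z \<le> - ln r" using up by simp
  hence "exp (ln r) \<le> exp (- z)" by (intro exp_mono) simp
  thus ?thesis using r by (simp add: z exp_ereal_def)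
qed

section \<open>Averages over boxes\<close>

text \<open>Functions of disjoint blocks of independent variables are independent. \<open>Y\<close>
  need only agree with them on the sample space, as only preimages inside it matter.\<close>

lemma (in prob_space) indep_vars_blocks:
  assumes "indep_vars M' X I" "\<And>j. j \<in> L \<Longrightarrow> K j \<subseteq> I" "disjoint_family_on K L"
    "\<And>j. j \<in> L \<Longrightarrow> h j \<in> measurable (PiM (K j) M') (N j)"
    "\<And>j \<omega>. j \<in> L \<Longrightarrow> \<omega> \<in> space M \<Longrightarrow> Y j \<omega> = h j (\<lambda>i\<in>K j. X i \<omega>)"
  shows "indep_vars N Y L"
proof -
  have 1: "indep_vars N (\<lambda>j \<omega>. h j (\<lambda>i\<in>K j. X i \<omega>)) L"
    by (rule indep_vars_compose2[OF indep_vars_restrict[OF assms(1-3)] assms(4)])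
  have eq: "Y j -` A \<inter> space M = (\<lambda>\<omega>. h j (\<lambda>i\<in>K j. X i \<omega>)) -` A \<inter> space M" if "j \<in> L" for j A
    using assms(5)[OF that] by auto
  have m: "(Y j \<in> measurable M (N j)) = ((\<lambda>\<omega>. h j (\<lambda>i\<in>K j. X i \<omega>)) \<in> measurable M (N j))" if "j \<in> L" for j
    using assms(5)[OF that] by (intro measurable_cong) auto
  show ?thesis
    using 1 m unfolding indep_vars_def2
    by (auto simp: eq cong: indep_sets_cong)
qed

text \<open>The two entries of the minimum come from two bounds on the sum: the triangle inequality
  gives \<open>A_fun\<close>, Rosenthal's inequality with the maximum as \<open>m\<close> gives
  \<open>V_fun\<close>.\<close>

lemma (in prob_space) Lp_norm_average_le_Theta:
  fixes \<zeta> :: "nat \<Rightarrow> 'a \<Rightarrow> real"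
  assumes p: "2 \<le> p" and n: "1 \<le> n" and ind: "indep_vars (\<lambda>_. borel) \<zeta> {1..n}"
    and nn: "\<And>j \<omega>. j \<in> {1..n} \<Longrightarrow> \<omega> \<in> space M \<Longrightarrow> 0 \<le> \<zeta> j \<omega>"
    and Lp: "\<And>j. j \<in> {1..n} \<Longrightarrow> \<zeta> j \<in> Lp_space M p"
  shows "Lp_norm M p (\<lambda>\<omega>. (\<Sum>j=1..n. \<zeta> j \<omega>) / real n) \<le> Theta M p n \<zeta>"
proof -
  let ?S = "\<lambda>\<omega>. \<Sum>j=1..n. \<zeta> j \<omega>"
  let ?N = "Lp_norm M p ?S"
  have S: "?S \<in> Lp_space M p" and tri: "?N \<le> (\<Sum>j=1..n. Lp_norm M p (\<zeta> j))"
    using Lp_sum[of p "{1..n}" \<zeta> M] p Lp by auto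
  have mom: "moment M \<zeta> j p = (\<integral>\<omega>. \<bar>\<zeta> j \<omega>\<bar> powr p \<partial>M)" if "j \<in> {1..n}" for j
    unfolding moment_def using nn[OF that] by (intro Bochner_Integration.integral_cong) auto
  have mom1: "moment M \<zeta> j 1 = expectation (\<zeta> j)" if "j \<in> {1..n}" for j
    unfolding moment_def using nn[OF that] by (intro Bochner_Integration.integral_cong) auto
  have mp0: "0 \<le> moment M \<zeta> j q" for j q by (simp add: moment_def)
  have "(\<Sum>j=1..n. Lp_norm M p (\<zeta> j)) = (\<Sum>j=1..n. moment M \<zeta> j p powr (1 / p))"
    by (intro sum.cong) (simp_all add: Lp_norm_def mom)
  hence A: "?N \<le> (\<Sum>j=1..n. moment M \<zeta> j p powr (1 / p))" using tri by simp
  define m where "m = max ((\<Sum>j=1..n. moment M \<zeta> j p) powr (1 / p)) (\<Sum>j=1..n. moment M \<zeta> j 1)"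
  have V: "?N \<le> bell_fun p powr (1 / p) * m"
  proof (cases "0 < m")
    case True
    have int: "integrable M (\<lambda>\<omega>. \<zeta> j \<omega> powr p)" if "j \<in> {1..n}" for j
    proof -
      have "integrable M (\<lambda>\<omega>. \<bar>\<zeta> j \<omega>\<bar> powr p)" using Lp[OF that] by (simp add: Lp_space_def)
      thus ?thesis
        using nn[OF that] by (subst (asm) Bochner_Integration.integrable_cong[OF refl]) auto
    qed
    have "(\<Sum>j=1..n. moment M \<zeta> j p) powr (1 / p) \<le> m" by (simp add: m_def)
    hence "((\<Sum>j=1..n. moment M \<zeta> j p) powr (1 / p)) powr p \<le> m powr p"
      using p by (intro powr_mono2) auto
    hence "(\<Sum>j=1..n. moment M \<zeta> j p) \<le> m powr p"
      using p mp0 by (simp add: powr_powr sum_nonneg)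
    hence "expectation (\<lambda>\<omega>. ?S \<omega> powr p) \<le> bell_fun p * m powr p"
      using True p nn int mom1
      by (intro rosenthal_bell ind) (auto simp: m_def moment_def[symmetric])
    also have "\<dots> = (bell_fun p powr (1 / p) * m) powr p"
      using bell_fun_pos[of p] p True by (simp add: powr_mult powr_powr)
    also have "expectation (\<lambda>\<omega>. ?S \<omega> powr p) = (\<integral>\<omega>. \<bar>?S \<omega>\<bar> powr p \<partial>M)"
      using nn by (intro Bochner_Integration.integral_cong) (auto intro!: arg_cong[where f = "\<lambda>x. x powr p"] sum_nonneg abs_of_nonneg[symmetric])
    finally show ?thesis using p True by (intro Lp_norm_leI) auto
  next
    case False
    \<comment> \<open>Then all \<open>p\<close>-th moments vanish and the triangle inequality suffices.\<close>
    have "0 \<le> (\<Sum>j=1..n. moment M \<zeta> j p)" using mp0 by (intro sum_nonneg)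
    moreover have "(\<Sum>j=1..n. moment M \<zeta> j p) powr (1 / p) \<le> 0"
      using False unfolding m_def by linarith
    hence "(\<Sum>j=1..n. moment M \<zeta> j p) = 0" by (metis powr_gt_zero linorder_not_less)
    hence "\<And>j. j \<in> {1..n} \<Longrightarrow> moment M \<zeta> j p = 0"
      using mp0 by (subst (asm) sum_nonneg_eq_0_iff) auto
    hence "?N \<le> 0" using A by simp
    moreover have "0 \<le> m" by (simp add: m_def le_max_iff_disj)
    ultimately show ?thesis by (smt (verit) mult_nonneg_nonneg powr_ge_zero)
  qed
  have "Lp_norm M p (\<lambda>\<omega>. ?S \<omega> / real n) = ?N / real n"
    using Lp_cmult(2)[OF _ S, of "1 / real n"] p by simp
  moreover have "?N / real n \<le> A_fun M p n \<zeta>"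
    unfolding A_fun_def by (rule divide_right_mono[OF A]) simp
  moreover have "?N / real n \<le> V_fun M p n \<zeta>"
    using divide_right_mono[OF V, of "real n"] unfolding V_fun_def m_def by simp
  ultimately show ?thesis by (simp add: Theta_def)
qed

section \<open>Sampling from the product space\<close>

locale product_sample = prob_space P for P :: "'w measure" +
  fixes d :: nat and \<mu> :: "nat \<Rightarrow> 'a measure" and \<xi> :: "nat \<Rightarrow> nat \<Rightarrow> 'w \<Rightarrow> 'a"
  assumes d: "1 \<le> d"
    and indep: "indep_vars (\<lambda>(s, i). \<mu> s) (\<lambda>(s, i). \<xi> s i) ({1..d} \<times> {1..})"
    and law: "\<And>s i. s \<in> {1..d} \<Longrightarrow> 1 \<le> i \<Longrightarrow> distr P (\<mu> s) (\<xi> s i) = \<mu> s"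
begin

abbreviation "\<Pi>\<mu> \<equiv> Pi\<^sub>M {1..d} \<mu>"

definition point :: "(nat \<Rightarrow> nat) \<Rightarrow> 'w \<Rightarrow> nat \<Rightarrow> 'a" where
  "point k \<omega> = (\<lambda>s\<in>{1..d}. \<xi> s (k s) \<omega>)"

lemma xi_measurable [measurable]:
  assumes "s \<in> {1..d}" "1 \<le> i"
  shows "\<xi> s i \<in> measurable P (\<mu> s)"
  using indep assms unfolding indep_vars_def by auto

lemma box_of_D: "n \<in> side_lengths d \<Longrightarrow> k \<in> box_of d n \<Longrightarrow> s \<in> {1..d} \<Longrightarrow> k s \<in> {1..n s}"
  by (auto simp: box_of_def PiE_iff)

text \<open>The coordinates of a sample point belong to different \<open>s\<close>, hence are
  independent for every multi-index.\<close>

lemma distr_point: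
  assumes k: "\<And>s. s \<in> {1..d} \<Longrightarrow> 1 \<le> k s"
  shows "point k \<in> measurable P \<Pi>\<mu>" "distr P \<Pi>\<mu> (point k) = \<Pi>\<mu>"
proof -
  show "point k \<in> measurable P \<Pi>\<mu>"
    unfolding point_def[abs_def] using k by (intro measurable_restrict) auto
  have ind: "indep_vars \<mu> (\<lambda>s. \<xi> s (k s)) {1..d}"
  proof (rule indep_vars_blocks[OF indep, where K = "\<lambda>s. {(s, k s)}" and h = "\<lambda>s x. x (s, k s)"])
    fix s assume "s \<in> {1..d}"
    show "(\<lambda>x. x (s, k s)) \<in> measurable (PiM {(s, k s)} (\<lambda>(s, i). \<mu> s)) (\<mu> s)"
      using measurable_component_singleton[of "(s, k s)" "{(s, k s)}" "\<lambda>(s, i). \<mu> s"] by simp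
  qed (use k in \<open>auto simp: disjoint_family_on_def\<close>)
  have "distr P \<Pi>\<mu> (point k) = (\<Pi>\<^sub>M s\<in>{1..d}. distr P (\<mu> s) (\<xi> s (k s)))"
    unfolding point_def[abs_def] using ind k d
    by (subst (asm) indep_vars_iff_distr_eq_PiM') auto
  also have "\<dots> = \<Pi>\<mu>" using law k by (intro PiM_cong) auto
  finally show "distr P \<Pi>\<mu> (point k) = \<Pi>\<mu>" .
qed

lemma point_space: "(\<And>s. s \<in> {1..d} \<Longrightarrow> 1 \<le> k s) \<Longrightarrow> \<omega> \<in> space P \<Longrightarrow> point k \<omega> \<in> space \<Pi>\<mu>"
  using distr_point(1)[of k] by (auto dest: measurable_space)

lemma Lp_point:
  assumes k: "\<And>s. s \<in> {1..d} \<Longrightarrow> 1 \<le> k s" and h: "h \<in> borel_measurable \<Pi>\<mu>"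
  shows "Lp_norm P p (\<lambda>\<omega>. h (point k \<omega>)) = Lp_norm \<Pi>\<mu> p h"
    and "(\<lambda>\<omega>. h (point k \<omega>)) \<in> Lp_space P p \<longleftrightarrow> h \<in> Lp_space \<Pi>\<mu> p"
  using Lp_distr[OF distr_point(1)[OF k] h, where p = p] distr_point(2)[OF k] by auto

lemma Lp_coordinate:
  assumes "s \<in> {1..d}" "1 \<le> i" "h \<in> Lp_space (\<mu> s) p"
  shows "(\<lambda>\<omega>. h (\<xi> s i \<omega>)) \<in> Lp_space P p"
  using Lp_distr(2)[OF xi_measurable[OF assms(1,2)], of h p] law[OF assms(1,2)] assms(3)
  by (simp add: Lp_space_def)

lemma box_finite: "finite (box_of d n)"
  by (auto simp: box_of_def intro: finite_PiE)

lemma card_box_pos: "n \<in> side_lengths d \<Longrightarrow> 0 < card (box_of d n)"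
  by (auto simp: box_of_def card_PiE side_lengths_def Suc_le_eq)

text \<open>Distinct multi-indices may share coordinates, so the sample points are in general
  dependent; the argument rests on their common law and the triangle inequality.\<close>

lemma S_avg_Lp:
  assumes p: "1 \<le> p" and n: "n \<in> side_lengths d" and h: "h \<in> Lp_space \<Pi>\<mu> p"
  shows "S_avg d \<xi> (box_of d n) h \<in> Lp_space P p"
    and "Lp_norm P p (S_avg d \<xi> (box_of d n) h) \<le> Lp_norm \<Pi>\<mu> p h"
proof -
  let ?L = "box_of d n"
  have k1: "1 \<le> k s" if "k \<in> ?L" "s \<in> {1..d}" for k s
    using box_of_D[OF n that] by simp
  have Lp: "(\<lambda>\<omega>. h (point k \<omega>)) \<in> Lp_space P p" if "k \<in> ?L" for k
    using Lp_point(2)[of k h p] k1[OF that] h by (simp add: Lp_space_def)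
  have eq: "S_avg d \<xi> ?L h = (\<lambda>\<omega>. (1 / real (card ?L)) * (\<Sum>k\<in>?L. h (point k \<omega>)))"
    by (auto simp: S_avg_def point_def)
  note sum = Lp_sum[OF p box_finite Lp]
  show "S_avg d \<xi> ?L h \<in> Lp_space P p"
    unfolding eq using p by (intro Lp_cmult(1) sum(1)) auto
  have "Lp_norm P p (S_avg d \<xi> ?L h) = (1 / real (card ?L)) * Lp_norm P p (\<lambda>\<omega>. \<Sum>k\<in>?L. h (point k \<omega>))"
    unfolding eq using p by (subst Lp_cmult(2)[OF _ sum(1)]) auto
  also have "\<dots> \<le> (1 / real (card ?L)) * (\<Sum>k\<in>?L. Lp_norm P p (\<lambda>\<omega>. h (point k \<omega>)))"
    by (intro mult_left_mono sum(2)) auto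
  also have "(\<Sum>k\<in>?L. Lp_norm P p (\<lambda>\<omega>. h (point k \<omega>))) = (\<Sum>k\<in>?L. Lp_norm \<Pi>\<mu> p h)"
    using k1 h by (intro sum.cong refl Lp_point(1)) (auto simp: Lp_space_def)
  finally show "Lp_norm P p (S_avg d \<xi> ?L h) \<le> Lp_norm \<Pi>\<mu> p h"
    using card_box_pos[OF n] by simp
qed

text \<open>Integrability is checked on \<open>P\<close>: at the sample point with all indices 1 the
  factors are independent random variables, and the law of that point carries the result
  back.\<close>

lemma tensor_Lp:
  assumes "0 < p" "\<And>s. s \<in> {1..d} \<Longrightarrow> h s \<in> Lp_space (\<mu> s) p"
  shows "(\<lambda>x. \<Prod>s\<in>{1..d}. h s (x s)) \<in> Lp_space \<Pi>\<mu> p"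
proof -
  have meas: "h s \<in> borel_measurable (\<mu> s)" if "s \<in> {1..d}" for s
    using assms(2)[OF that] by (simp add: Lp_space_def)
  have prod_meas: "(\<lambda>x. \<Prod>s\<in>{1..d}. h s (x s)) \<in> borel_measurable \<Pi>\<mu>"
  proof (intro borel_measurable_prod)
    fix s assume s: "s \<in> {1..d}"
    show "(\<lambda>x. h s (x s)) \<in> borel_measurable \<Pi>\<mu>"
      using measurable_compose[OF measurable_component_singleton[OF s, of \<mu>] meas[OF s]] by simp
  qed
  have "indep_vars (\<lambda>_. borel) (\<lambda>s \<omega>. h s (\<xi> s 1 \<omega>)) {1..d}"
  proof (rule indep_vars_blocks[OF indep, where K = "\<lambda>s. {(s, 1)}" and h = "\<lambda>s x. h s (x (s, 1))"])
    fix s assume s: "s \<in> {1..d}"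
    show "(\<lambda>x. h s (x (s, 1))) \<in> borel_measurable (PiM {(s, 1)} (\<lambda>(s, i). \<mu> s))"
      using measurable_component_singleton[of "(s, 1)" "{(s, 1)}" "\<lambda>(s, i). \<mu> s"] meas[OF s]
      by (auto intro: measurable_compose)
  qed (auto simp: disjoint_family_on_def)
  hence "(\<lambda>\<omega>. \<Prod>s\<in>{1..d}. h s (\<xi> s 1 \<omega>)) \<in> Lp_space P p"
    using assms d by (intro Lp_prod_indep(1) prob_space_axioms Lp_coordinate) auto
  hence "(\<lambda>\<omega>. \<Prod>s\<in>{1..d}. h s (point (\<lambda>_. 1) \<omega> s)) \<in> Lp_space P p"
    by (simp add: point_def)
  thus ?thesis using Lp_point(2)[of "\<lambda>_. 1", OF _ prod_meas, of p] by simp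
qed

text \<open>Over a box, a sum of products is a product of sums. The factors \<open>Y s\<close> use
  the disjoint blocks \<open>{s} \<times> {1..n s}\<close>, so the norm is multiplicative and each
  factor is bounded by its \<open>Theta\<close>.\<close>

lemma tensor_average_Lp:
  assumes p: "2 \<le> p" and n: "n \<in> side_lengths d"
    and h: "\<And>s. s \<in> {1..d} \<Longrightarrow> h s \<in> Lp_space (\<mu> s) p"
    and h0: "\<And>s x. s \<in> {1..d} \<Longrightarrow> x \<in> space (\<mu> s) \<Longrightarrow> 0 \<le> h s x"
  shows "Lp_norm P p (S_avg d \<xi> (box_of d n) (\<lambda>x. \<Prod>s\<in>{1..d}. h s (x s)))
     \<le> (\<Prod>s\<in>{1..d}. Theta P p (n s) (\<lambda>i \<omega>. h s (\<xi> s i \<omega>)))"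
proof -
  have meas: "h s \<in> borel_measurable (\<mu> s)" if "s \<in> {1..d}" for s
    using h[OF that] by (simp add: Lp_space_def)
  have n1: "1 \<le> n s" if "s \<in> {1..d}" for s using n that by (simp add: side_lengths_def)
  define Y where "Y s \<omega> = (\<Sum>i=1..n s. h s (\<xi> s i \<omega>)) / real (n s)" for s \<omega>
  have eq: "S_avg d \<xi> (box_of d n) (\<lambda>x. \<Prod>s\<in>{1..d}. h s (x s)) = (\<lambda>\<omega>. \<Prod>s\<in>{1..d}. Y s \<omega>)"
  proof
    fix \<omega>
    have "(\<Sum>k\<in>box_of d n. \<Prod>s\<in>{1..d}. h s (\<xi> s (k s) \<omega>)) = (\<Prod>s\<in>{1..d}. \<Sum>i=1..n s. h s (\<xi> s i \<omega>))"
      unfolding box_of_def by (rule prod_sum_PiE[symmetric]) auto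
    thus "S_avg d \<xi> (box_of d n) (\<lambda>x. \<Prod>s\<in>{1..d}. h s (x s)) \<omega> = (\<Prod>s\<in>{1..d}. Y s \<omega>)"
      by (simp add: S_avg_def Y_def prod_dividef box_of_def card_PiE)
  qed
  have Yind: "indep_vars (\<lambda>_. borel) Y {1..d}"
  proof (rule indep_vars_blocks[OF indep, where K = "\<lambda>s. {s} \<times> {1..n s}"
        and h = "\<lambda>s x. (\<Sum>i=1..n s. h s (x (s, i))) / real (n s)"])
    fix s assume s: "s \<in> {1..d}"
    have "(\<lambda>x. h s (x (s, i))) \<in> borel_measurable (PiM ({s} \<times> {1..n s}) (\<lambda>(s, i). \<mu> s))" if "i \<in> {1..n s}" for i
      using measurable_component_singleton[of "(s, i)" "{s} \<times> {1..n s}" "\<lambda>(s, i). \<mu> s"] meas[OF s] that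
      by (auto intro: measurable_compose)
    thus "(\<lambda>x. (\<Sum>i=1..n s. h s (x (s, i))) / real (n s)) \<in> borel_measurable (PiM ({s} \<times> {1..n s}) (\<lambda>(s, i). \<mu> s))"
      by measurable
  qed (auto simp: disjoint_family_on_def Y_def)
  have hLp: "(\<lambda>\<omega>. h s (\<xi> s i \<omega>)) \<in> Lp_space P p" if "s \<in> {1..d}" "i \<in> {1..n s}" for s i
    using that h by (intro Lp_coordinate) auto
  have YLp: "Y s \<in> Lp_space P p" if "s \<in> {1..d}" for s
    using Lp_cmult(1)[OF _ Lp_sum(1)[of p "{1..n s}" "\<lambda>i \<omega>. h s (\<xi> s i \<omega>)" P], of "1 / real (n s)"] hLp[OF that] p
    by (simp add: Y_def[abs_def])
  have "Lp_norm P p (Y s) \<le> Theta P p (n s) (\<lambda>i \<omega>. h s (\<xi> s i \<omega>))" if s: "s \<in> {1..d}" for s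
    unfolding Y_def[abs_def]
  proof (rule Lp_norm_average_le_Theta[OF p n1[OF s]])
    show "indep_vars (\<lambda>_. borel) (\<lambda>i \<omega>. h s (\<xi> s i \<omega>)) {1..n s}"
    proof (rule indep_vars_blocks[OF indep, where K = "\<lambda>i. {(s, i)}" and h = "\<lambda>i x. h s (x (s, i))"])
      fix i
      show "(\<lambda>x. h s (x (s, i))) \<in> borel_measurable (PiM {(s, i)} (\<lambda>(s, i). \<mu> s))"
        using measurable_component_singleton[of "(s, i)" "{(s, i)}" "\<lambda>(s, i). \<mu> s"] meas[OF s]
        by (auto intro: measurable_compose)
    qed (use s in \<open>auto simp: disjoint_family_on_def\<close>)
    show "0 \<le> h s (\<xi> s j \<omega>)" if "j \<in> {1..n s}" "\<omega> \<in> space P" for j \<omega>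
      using that s measurable_space[OF xi_measurable[OF s, of j]] by (intro h0) auto
  qed (use hLp s in auto)
  moreover have "Lp_norm P p (\<lambda>\<omega>. \<Prod>s\<in>{1..d}. Y s \<omega>) = (\<Prod>s\<in>{1..d}. Lp_norm P p (Y s))"
    using p d YLp by (intro Lp_prod_indep(2) prob_space_axioms Yind) auto
  ultimately show ?thesis
    unfolding eq by (auto intro!: prod_mono simp: Lp_norm_nonneg)
qed

lemma Dplus_repr_Lp:
  assumes p: "1 \<le> p" and r: "Dplus_repr d \<mu> p M ft lam g"
  shows "ft \<in> Lp_space \<Pi>\<mu> p"
proof -
  have "(\<lambda>x. \<Sum>k\<in>box_of d (\<lambda>_. M). lam k * (\<Prod>s\<in>{1..d}. g s (k s) (x s))) \<in> Lp_space \<Pi>\<mu> p"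
  proof (intro Lp_sum(1) Lp_cmult(1) tensor_Lp box_finite p)
    fix k s assume "k \<in> box_of d (\<lambda>_. M)" "s \<in> {1..d}"
    hence "k s \<in> {1..M}" by (auto simp: box_of_def PiE_iff)
    thus "g s (k s) \<in> Lp_space (\<mu> s) p" using r \<open>s \<in> {1..d}\<close> by (simp add: Dplus_repr_def)
  qed (use p in auto)
  thus ?thesis using r by (subst Lp_space_cong) (auto simp: Dplus_repr_def)
qed

text \<open>Averaging is linear in the function; the coefficients may be negative, hence the
  absolute values after the triangle inequality.\<close>

lemma Lp_norm_S_avg_repr_le:
  assumes p: "2 \<le> p" and n: "n \<in> side_lengths d" and r: "Dplus_repr d \<mu> p M ft lam g"
  shows "Lp_norm P p (S_avg d \<xi> (box_of d n) ft) \<le> Theta_box P \<xi> d p n M lam g"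
proof -
  let ?L = "box_of d n" and ?M = "box_of d (\<lambda>_. M)"
  let ?T = "\<lambda>k x. \<Prod>s\<in>{1..d}. g s (k s) (x s)"
  have kM: "k s \<in> {1..M}" if "k \<in> ?M" "s \<in> {1..d}" for k s
    using that by (auto simp: box_of_def PiE_iff)
  have g: "g s (k s) \<in> Lp_space (\<mu> s) p" "\<And>x. x \<in> space (\<mu> s) \<Longrightarrow> 0 \<le> g s (k s) x"
    if "k \<in> ?M" "s \<in> {1..d}" for k s
    using r kM[OF that] that by (auto simp: Dplus_repr_def)
  have TLp: "S_avg d \<xi> ?L (?T k) \<in> Lp_space P p" if "k \<in> ?M" for k
    using p n g[OF that] by (intro S_avg_Lp tensor_Lp) auto
  have "S_avg d \<xi> ?L ft \<omega> = (\<Sum>k\<in>?M. lam k * S_avg d \<xi> ?L (?T k) \<omega>)" if \<omega>: "\<omega> \<in> space P" for \<omega>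
  proof -
    have "ft (point j \<omega>) = (\<Sum>k\<in>?M. lam k * ?T k (point j \<omega>))" if "j \<in> ?L" for j
      using r point_space[of j \<omega>] box_of_D[OF n that] \<omega> by (simp add: Dplus_repr_def)
    hence "(\<Sum>j\<in>?L. ft (point j \<omega>)) = (\<Sum>j\<in>?L. \<Sum>k\<in>?M. lam k * ?T k (point j \<omega>))"
      by (intro sum.cong) auto
    also have "\<dots> = (\<Sum>k\<in>?M. lam k * (\<Sum>j\<in>?L. ?T k (point j \<omega>)))"
      by (subst sum.swap) (simp add: sum_distrib_left)
    finally have "(\<Sum>j\<in>?L. ft (point j \<omega>)) = (\<Sum>k\<in>?M. lam k * (\<Sum>j\<in>?L. ?T k (point j \<omega>)))" .
    moreover have "(\<Sum>k\<in>?M. lam k * A k) / c = (\<Sum>k\<in>?M. lam k * (A k / c))" for A c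
      by (simp add: sum_divide_distrib)
    ultimately show ?thesis
      unfolding S_avg_def point_def[symmetric] by simp
  qed
  hence "Lp_norm P p (S_avg d \<xi> ?L ft) = Lp_norm P p (\<lambda>\<omega>. \<Sum>k\<in>?M. lam k * S_avg d \<xi> ?L (?T k) \<omega>)"
    by (rule Lp_norm_cong)
  also have "\<dots> \<le> (\<Sum>k\<in>?M. Lp_norm P p (\<lambda>\<omega>. lam k * S_avg d \<xi> ?L (?T k) \<omega>))"
    using p TLp by (intro Lp_sum(2) Lp_cmult(1) box_finite) auto
  also have "\<dots> = (\<Sum>k\<in>?M. \<bar>lam k\<bar> * Lp_norm P p (S_avg d \<xi> ?L (?T k)))"
    using p TLp by (intro sum.cong refl Lp_cmult(2)) auto
  also have "\<dots> \<le> Theta_box P \<xi> d p n M lam g"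
    unfolding Theta_box_def using p n g
    by (intro sum_mono mult_left_mono tensor_average_Lp) auto
  finally show ?thesis .
qed

lemma Lp_norm_S_avg_le_W:
  assumes p: "2 \<le> p" "p \<in> I" and n: "n \<in> side_lengths d"
    and f: "f \<in> Lp_space \<Pi>\<mu> p" and opt: "optimal_choice d \<mu> f I Z lam g"
  shows "Lp_norm P p (S_avg d \<xi> (box_of d n) f) \<le> W_fun P \<xi> d \<mu> f lam g n p"
  unfolding W_fun_def
\<comment> \<open>The norm does not depend on \<open>M\<close>, so a bound for each
  \<open>M \<ge> 1\<close> gives one by the infimum.\<close>
proof (rule cINF_greatest)
  fix M :: nat assume "M \<in> {1..}"
  hence r: "Dplus_repr d \<mu> p M (Z p M) (lam p M) (g p M)"
    and Q: "Lp_norm \<Pi>\<mu> p (\<lambda>x. f x - Z p M x) = Qplus d \<mu> p M f"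
    using opt p by (auto simp: optimal_choice_def)
  let ?S = "S_avg d \<xi> (box_of d n)"
  have Z: "Z p M \<in> Lp_space \<Pi>\<mu> p" using p by (intro Dplus_repr_Lp[OF _ r]) auto
  have diff: "(\<lambda>x. f x - Z p M x) \<in> Lp_space \<Pi>\<mu> p"
    using Lp_add(1)[OF _ f Lp_cmult(1)[OF _ Z, of "-1"]] p by simp
  have "?S f = (\<lambda>\<omega>. ?S (Z p M) \<omega> + ?S (\<lambda>x. f x - Z p M x) \<omega>)"
    by (auto simp: S_avg_def sum_subtractf diff_divide_distrib)
  hence "Lp_norm P p (?S f) \<le> Lp_norm P p (?S (Z p M)) + Lp_norm P p (?S (\<lambda>x. f x - Z p M x))"
    using Lp_add(2)[OF _ S_avg_Lp(1)[OF _ n Z] S_avg_Lp(1)[OF _ n diff]] p by simp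
  also have "\<dots> \<le> Theta_box P \<xi> d p n M (lam p M) (g p M) + Qplus d \<mu> p M f"
    using p n by (intro add_mono Lp_norm_S_avg_repr_le r S_avg_Lp(2)[OF _ n diff, unfolded Q]) auto
  finally show "Lp_norm P p (?S f) \<le> Theta_box P \<xi> d p n M (lam p M) (g p M) + Qplus d \<mu> p M f" .
qed auto

text \<open>Markov's inequality in the shape of the last premise of
  \<open>exp_ereal_neg_zeta_star_ge\<close>.\<close>

lemma tail_le_of_Lp_norm_le:
  assumes "0 < p" "S \<in> Lp_space P p" "Lp_norm P p S \<le> c" "0 < y"
  shows "0 \<le> c \<and> measure P {\<omega> \<in> space P. y \<le> S \<omega>} \<le> (c / y) powr p"
proof -
  have "measure P {\<omega> \<in> space P. y \<le> S \<omega>} \<le> (Lp_norm P p S / y) powr p"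
    using assms by (intro Lp_markov prob_space_axioms)
  also have "\<dots> \<le> (c / y) powr p"
    using assms Lp_norm_nonneg[of P p S] by (intro powr_mono2 divide_right_mono) auto
  finally show ?thesis using assms(3) Lp_norm_nonneg[of P p S] by linarith
qed

end

theorem proposition6p1:
  fixes d :: nat
    and \<mu> :: "nat \<Rightarrow> 'a measure"
    and P :: "'w measure"
    and \<xi> :: "nat \<Rightarrow> nat \<Rightarrow> 'w \<Rightarrow> 'a"
    and f :: "(nat \<Rightarrow> 'a) \<Rightarrow> real"
    and b :: ereal
    and Z :: "real \<Rightarrow> nat \<Rightarrow> (nat \<Rightarrow> 'a) \<Rightarrow> real"
    and lam :: "real \<Rightarrow> nat \<Rightarrow> (nat \<Rightarrow> nat) \<Rightarrow> real"
    and g :: "real \<Rightarrow> nat \<Rightarrow> nat \<Rightarrow> nat \<Rightarrow> 'a \<Rightarrow> real"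
  assumes "3 \<le> d"
    and "prob_space P"
    and "\<And>s. s \<in> {1..d} \<Longrightarrow> prob_space (\<mu> s)"
    and "prob_space.indep_vars P (\<lambda>(s, i). \<mu> s) (\<lambda>(s, i). \<xi> s i) ({1..d} \<times> {1..})"
    and "\<And>s i. s \<in> {1..d} \<Longrightarrow> 1 \<le> i \<Longrightarrow> distr P (\<mu> s) (\<xi> s i) = \<mu> s"
    and "f \<in> borel_measurable (Pi\<^sub>M {1..d} \<mu>)"
    and "\<And>x. x \<in> space (Pi\<^sub>M {1..d} \<mu>) \<Longrightarrow> 0 \<le> f x"
    and "2 < b"
    and "\<And>p. p \<in> p_range b \<Longrightarrow> f \<in> Lp_space (Pi\<^sub>M {1..d} \<mu>) p"
    and "optimal_choice d \<mu> f (p_range b) Z lam g"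
    and "\<And>p. p \<in> p_range b \<Longrightarrow> bdd_above ((\<lambda>n. W_fun P \<xi> d \<mu> f lam g n p) ` side_lengths d)"
  shows "(\<forall>n\<in>side_lengths d. \<forall>y\<ge>exp 1.
            ereal (measure P {\<omega> \<in> space P. y \<le> S_avg d \<xi> (box_of d n) f \<omega>})
              \<le> exp_ereal (- zeta_star b (W_fun P \<xi> d \<mu> f lam g n) (ln y))) \<and>
         (\<forall>y\<ge>exp 1.
            (SUP n\<in>side_lengths d.
               ereal (measure P {\<omega> \<in> space P. y \<le> S_avg d \<xi> (box_of d n) f \<omega>}))
              \<le> exp_ereal (- zeta_star b (nu_sup P \<xi> d \<mu> f lam g) (ln y)))"
proof -
  interpret prob_space P by fact
  interpret product_sample P d \<mu> \<xi>
    using assms by unfold_locales auto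
  have ne: "p_range b \<noteq> {}"
    using assms(8) by (auto simp: p_range_def intro!: exI[of _ 2])
  have p2: "2 \<le> p" if "p \<in> p_range b" for p using that by (simp add: p_range_def)
  have y0: "0 < y" if "exp 1 \<le> y" for y :: real
    using that exp_gt_zero[of "1::real"] by linarith
  have SLp: "S_avg d \<xi> (box_of d n) f \<in> Lp_space P p" if "n \<in> side_lengths d" "p \<in> p_range b" for n p
    using that assms(9) p2 by (intro S_avg_Lp) fastforce+
  have W: "Lp_norm P p (S_avg d \<xi> (box_of d n) f) \<le> W_fun P \<xi> d \<mu> f lam g n p"
    if "n \<in> side_lengths d" "p \<in> p_range b" for n p
    using that assms(9,10) p2 by (intro Lp_norm_S_avg_le_W) auto
  \<comment> \<open>Boundedness of the family makes the real-valued supremum a genuine upper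
    bound.\<close>
  have nu: "W_fun P \<xi> d \<mu> f lam g n p \<le> nu_sup P \<xi> d \<mu> f lam g p"
    if "n \<in> side_lengths d" "p \<in> p_range b" for n p
    unfolding nu_sup_def using that assms(11) by (intro cSUP_upper)
  \<comment> \<open>Any \<open>\<psi>\<close> above the norms is allowed, so both claims follow:
    with \<open>W_fun\<close> for a fixed box, and with \<open>nu_sup\<close>, whose bound is the
    same for all boxes.\<close>
  have tail: "ereal (measure P {\<omega> \<in> space P. y \<le> S_avg d \<xi> (box_of d n) f \<omega>})
      \<le> exp_ereal (- zeta_star b \<psi> (ln y))"
    if n: "n \<in> side_lengths d" and y: "exp 1 \<le> y"
      and "\<And>p. p \<in> p_range b \<Longrightarrow> Lp_norm P p (S_avg d \<xi> (box_of d n) f) \<le> \<psi> p" for n y \<psi>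
    using that p2 y0[OF y] ne SLp[OF n]
    by (intro exp_ereal_neg_zeta_star_ge tail_le_of_Lp_norm_le) fastforce+
  show ?thesis
    using tail W order_trans[OF W nu] by (auto intro!: SUP_least)
qed

end
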